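(* Let $\boldsymbol{X}\sim SN_{n\times p}(\mathbf{M},\mathbf{\Omega},\mathbf{B},\boldsymbol{\delta})$ and $\boldsymbol{Y}\sim SN_{n\times p}(\mathbf{M}',\mathbf{\Omega}',\mathbf{B}',\boldsymbol{\delta}')$, where $\mathbf{M},\mathbf{M}',\mathbf{B},\mathbf{B}'\in\mathbb{R}^{n\times p}$, $\boldsymbol{\delta},\boldsymbol{\delta}'\in\mathbb{R}^{np}$, $\mathbf{\Omega}=\mathbf{V}\otimes\boldsymbol{\Sigma}$, $\mathbf{\Omega}'=\mathbf{V}'\otimes\boldsymbol{\Sigma}'$, with $\mathbf{V},\mathbf{V}'$ ($p\times p$) and $\boldsymbol{\Sigma},\boldsymbol{\Sigma}'$ ($n\times n$) positive definite. Let also $\boldsymbol{X}_0\sim SN_{n\times p}(\boldsymbol{0}_{n\times p},\overline{\mathbf{\Omega}},*,\boldsymbol{\delta})$ and $\boldsymbol{Y}_0\sim SN_{n\times p}(\boldsymbol{0}_{n\times p},\overline{\mathbf{\Omega}'},*,\boldsymbol{\delta}')$, where $\overline{\mathbf{\Omega}},\overline{\mathbf{\Omega}'}$ are the correlation matrices associated with $\mathbf{\Omega},\mathbf{\Omega}'$. 1. If $\mathbf{M}=\mathbf{M}'$, $\boldsymbol{\delta}=\boldsymbol{\delta}'$ and $\mathbf{\Omega}'-\mathbf{\Omega}$ is positive semi-definite, then $\boldsymbol{X}\le_{cx}\boldsymbol{Y}$. 2. $\boldsymbol{X}_0\le_{cx}\boldsymbol{Y}_0$ if and only if $\boldsymbol{\delta}=\boldsymbol{\delta}'$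 and $\overline{\mathbf{\Omega}'}-\overline{\mathbf{\Omega}}$ is positive semi-definite.
   Context: Notation: $\mathrm{vec}$ stacks the columns of a matrix into one column vector, $\otimes$ is the Kronecker product. Multivariate skew-normal: for a positive definite $m\times m$ matrix $\mathbf{\Omega}=(\omega_{ij})$ put $\boldsymbol{\omega}=\mathrm{diag}\{\sqrt{\omega_{11}},\dots,\sqrt{\omega_{mm}}\}$ and let $\overline{\mathbf{\Omega}}=\boldsymbol{\omega}^{-1}\mathbf{\Omega}\boldsymbol{\omega}^{-1}$ be the associated correlation matrix. For $\boldsymbol{\mu},\boldsymbol{\alpha}\in\mathbb{R}^m$, $SN_m(\boldsymbol{\mu},\mathbf{\Omega},\boldsymbol{\alpha})$ is the distribution with density $2\phi_m(\boldsymbol{z};\boldsymbol{\mu},\mathbf{\Omega})\Phi(\boldsymbol{\alpha}^T\boldsymbol{\omega}^{-1}(\boldsymbol{z}-\boldsymbol{\mu}))$, where $\phi_m(\cdot;\boldsymbol{\mu},\mathbf{\Omega})$ is the $N_m(\boldsymbol{\mu},\mathbf{\Omega})$ density and $\Phi$ the standard normal distribution function. Its parameter $\boldsymbol{\delta}$ is $\boldsymbol{\delta}=(1+\boldsymbol{\alpha}^T\overline{\mathbf{\Omega}}\boldsymbol{\alpha})^{-1/2}\boldsymbol{\omega}\overline{\mathbf{\Omega}}\boldsymbol{\alpha}$; it satisfies $\boldsymbol{\delta}^T\mathbf{\Omega}^{-1}\boldsymbol{\delta}<1$ and determines $\boldsymbol{\alpha}=(1-\boldsymbol{\delta}^T\mathbf{\Omega}^{-1}\boldsymbol{\delta})^{-1/2}\boldsymbol{\omega}\mathbf{\Omega}^{-1}\boldsymbol{\delta}$.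 One writes $SN_m(\boldsymbol{\mu},\mathbf{\Omega},\boldsymbol{\alpha},\boldsymbol{\delta})$, with $*$ in place of $\boldsymbol{\alpha}$ or $\boldsymbol{\delta}$ when it is not displayed. Matrix variate skew-normal: an $n\times p$ random matrix satisfies $\boldsymbol{Z}\sim SN_{n\times p}(\mathbf{M},\mathbf{\Omega},\mathbf{B},\boldsymbol{\delta})$ iff $\mathrm{vec}(\boldsymbol{Z})\sim SN_{np}(\mathrm{vec}(\mathbf{M}),\mathbf{\Omega},\mathrm{vec}(\mathbf{B}),\boldsymbol{\delta})$; $*$ in place of $\mathbf{B}$ means it is the skewness parameter determined by $\boldsymbol{\delta}$ and the scale matrix (writing such a distribution presupposes that $\boldsymbol{\delta}$ is admissible for the scale matrix, i.e. the quadratic form of $\boldsymbol{\delta}$ in the inverse scale matrix is $<1$). Convex order: $\boldsymbol{X}\le_{cx}\boldsymbol{Y}$ means $Ef(\boldsymbol{X})\le Ef(\boldsymbol{Y})$ for all convex functions $f:\mathbb{R}^{n\times p}\to\mathbb{R}$ for which the expectations are well defined. *)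

theory Defs
  imports "HOL-Probability.Probability"
begin

section \<open>Matrices\<close>

text \<open>
  An $n \times p$ matrix has type \<open>real^'p^'n\<close>. Vectors of length $np$ and $np \times np$ matrices are
  indexed by pairs \<open>(j, i) :: 'p \<times> 'n\<close> instead of $1, \dots, np$; the pair $(j, i)$ stands for the
  position $(j - 1) n + i$. Stacking columns puts the entry in row $i$ and column $j$ at that
  position, and the outer index of a Kronecker product of a $p \times p$ with an $n \times n$ matrix
  is the first component.
\<close>

definition vectorize :: "real^'p^'n \<Rightarrow> real^('p \<times> 'n)" where
  "vectorize A = (\<chi> k. A $ snd k $ fst k)"

definition kronecker :: "real^'p^'p \<Rightarrow> real^'n^'n \<Rightarrow> real^('p \<times> 'n)^('p \<times> 'n)"
    (infixl "\<otimes>\<^sub>K" 70) where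
  "A \<otimes>\<^sub>K B = (\<chi> k l. A $ fst k $ fst l * B $ snd k $ snd l)"

definition pos_def :: "real^'m^'m \<Rightarrow> bool" where
  "pos_def A \<longleftrightarrow> transpose A = A \<and> (\<forall>x. x \<noteq> 0 \<longrightarrow> x \<bullet> (A *v x) > 0)"

definition pos_semidef :: "real^'m^'m \<Rightarrow> bool" where
  "pos_semidef A \<longleftrightarrow> transpose A = A \<and> (\<forall>x. x \<bullet> (A *v x) \<ge> 0)"

definition scale_diag :: "real^'m^'m \<Rightarrow> real^'m^'m" where
  "scale_diag \<Omega> = (\<chi> i j. if i = j then sqrt (\<Omega> $ i $ i) else 0)"

definition correlation :: "real^'m^'m \<Rightarrow> real^'m^'m" where
  "correlation \<Omega> = matrix_inv (scale_diag \<Omega>) ** \<Omega> ** matrix_inv (scale_diag \<Omega>)"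

section \<open>Skew-normal distributions\<close>

definition mvn_density :: "real^'m \<Rightarrow> real^'m^'m \<Rightarrow> real^'m \<Rightarrow> real" where
  "mvn_density \<mu> \<Omega> z =
     exp (- ((z - \<mu>) \<bullet> (matrix_inv \<Omega> *v (z - \<mu>))) / 2) / sqrt ((2 * pi) ^ CARD('m) * det \<Omega>)"

definition skew_normal_density ::
    "real^'m \<Rightarrow> real^'m^'m \<Rightarrow> real^'m \<Rightarrow> real^'m \<Rightarrow> real" where
  "skew_normal_density \<mu> \<Omega> \<alpha> z =
     2 * mvn_density \<mu> \<Omega> z
       * cdf std_normal_distribution (\<alpha> \<bullet> (matrix_inv (scale_diag \<Omega>) *v (z - \<mu>)))"

definition delta_of :: "real^'m^'m \<Rightarrow> real^'m \<Rightarrow> real^'m" where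
  "delta_of \<Omega> \<alpha> =
     (1 / sqrt (1 + \<alpha> \<bullet> (correlation \<Omega> *v \<alpha>))) *\<^sub>R (scale_diag \<Omega> *v (correlation \<Omega> *v \<alpha>))"

definition alpha_of :: "real^'m^'m \<Rightarrow> real^'m \<Rightarrow> real^'m" where
  "alpha_of \<Omega> \<delta> =
     (1 / sqrt (1 - \<delta> \<bullet> (matrix_inv \<Omega> *v \<delta>))) *\<^sub>R (scale_diag \<Omega> *v (matrix_inv \<Omega> *v \<delta>))"

definition admissible_delta :: "real^'m^'m \<Rightarrow> real^'m \<Rightarrow> bool" where
  "admissible_delta \<Omega> \<delta> \<longleftrightarrow> \<delta> \<bullet> (matrix_inv \<Omega> *v \<delta>) < 1"

definition has_skew_normal_law ::
    "'a measure \<Rightarrow> ('a \<Rightarrow> real^'m) \<Rightarrow> real^'m \<Rightarrow> real^'m^'m \<Rightarrow> real^'m \<Rightarrow> bool" where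
  "has_skew_normal_law P Z \<mu> \<Omega> \<alpha> \<longleftrightarrow>
     prob_space P \<and> pos_def \<Omega> \<and>
     distributed P lborel Z (\<lambda>z. ennreal (skew_normal_density \<mu> \<Omega> \<alpha> z))"

text \<open>$Z \sim SN_m(\mu, \Omega, \alpha, \delta)$ and $Z \sim SN_m(\mu, \Omega, *, \delta)$.\<close>

definition skew_normal ::
    "'a measure \<Rightarrow> ('a \<Rightarrow> real^'m) \<Rightarrow> real^'m \<Rightarrow> real^'m^'m \<Rightarrow> real^'m \<Rightarrow> real^'m \<Rightarrow> bool" where
  "skew_normal P Z \<mu> \<Omega> \<alpha> \<delta> \<longleftrightarrow> has_skew_normal_law P Z \<mu> \<Omega> \<alpha> \<and> \<delta> = delta_of \<Omega> \<alpha>"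

definition skew_normal_star ::
    "'a measure \<Rightarrow> ('a \<Rightarrow> real^'m) \<Rightarrow> real^'m \<Rightarrow> real^'m^'m \<Rightarrow> real^'m \<Rightarrow> bool" where
  "skew_normal_star P Z \<mu> \<Omega> \<delta> \<longleftrightarrow>
     admissible_delta \<Omega> \<delta> \<and> has_skew_normal_law P Z \<mu> \<Omega> (alpha_of \<Omega> \<delta>)"

definition matrix_skew_normal ::
    "'a measure \<Rightarrow> ('a \<Rightarrow> real^'p^'n) \<Rightarrow> real^'p^'n \<Rightarrow> real^('p \<times> 'n)^('p \<times> 'n) \<Rightarrow>
     real^'p^'n \<Rightarrow> real^('p \<times> 'n) \<Rightarrow> bool" where
  "matrix_skew_normal P Z M \<Omega> B \<delta> \<longleftrightarrow>
     skew_normal P (\<lambda>\<xi>. vectorize (Z \<xi>)) (vectorize M) \<Omega> (vectorize B) \<delta>"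

definition matrix_skew_normal_star ::
    "'a measure \<Rightarrow> ('a \<Rightarrow> real^'p^'n) \<Rightarrow> real^'p^'n \<Rightarrow> real^('p \<times> 'n)^('p \<times> 'n) \<Rightarrow>
     real^('p \<times> 'n) \<Rightarrow> bool" where
  "matrix_skew_normal_star P Z M \<Omega> \<delta> \<longleftrightarrow>
     skew_normal_star P (\<lambda>\<xi>. vectorize (Z \<xi>)) (vectorize M) \<Omega> \<delta>"

section \<open>Convex order\<close>

text \<open>
  An expectation is well defined if the positive or the negative part has a finite integral; its
  value is then an extended real. The Bochner integral would not do: it is 0 when the expectation
  is infinite. Note that \<open>ennreal\<close> truncates negative numbers to 0.
\<close>

definition expectation_defined :: "'a measure \<Rightarrow> ('a \<Rightarrow> real) \<Rightarrow> bool" where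
  "expectation_defined P g \<longleftrightarrow>
     g \<in> borel_measurable P \<and>
     ((\<integral>\<^sup>+\<xi>. ennreal (g \<xi>) \<partial>P) < \<infinity> \<or> (\<integral>\<^sup>+\<xi>. ennreal (- g \<xi>) \<partial>P) < \<infinity>)"

definition ext_expectation :: "'a measure \<Rightarrow> ('a \<Rightarrow> real) \<Rightarrow> ereal" where
  "ext_expectation P g =
     enn2ereal (\<integral>\<^sup>+\<xi>. ennreal (g \<xi>) \<partial>P) - enn2ereal (\<integral>\<^sup>+\<xi>. ennreal (- g \<xi>) \<partial>P)"

definition convex_order ::
    "'a measure \<Rightarrow> ('a \<Rightarrow> 'v::real_vector) \<Rightarrow> 'b measure \<Rightarrow> ('b \<Rightarrow> 'v) \<Rightarrow> bool" where
  "convex_order P X Q Y \<longleftrightarrow>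
     (\<forall>f. convex_on UNIV f \<longrightarrow>
          expectation_defined P (\<lambda>\<xi>. f (X \<xi>)) \<longrightarrow> expectation_defined Q (\<lambda>\<xi>. f (Y \<xi>)) \<longrightarrow>
          ext_expectation P (\<lambda>\<xi>. f (X \<xi>)) \<le> ext_expectation Q (\<lambda>\<xi>. f (Y \<xi>)))"

end

theory Submission
  imports Defs
begin

text \<open>
  Let \<open>X\<close> be skew-normal with location \<open>\<mu>\<close>, scale matrix \<open>\<Omega>\<close> and parameter \<open>\<delta>\<close>. Everything rests on the stochastic
  representation (\<open>skew_normal_representation\<close>): \<open>X\<close> has the law of \<open>\<mu> + U \<delta> + C V\<close>, where \<open>U\<close> is half-normal, \<open>V\<close> is
  standard Gaussian and independent of \<open>U\<close>, and \<open>C\<close> is any matrix with \<open>C C\<^sup>T = \<Omega> - \<delta> \<delta>\<^sup>T\<close>. It is obtained by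
  completing a square in the joint density of \<open>U\<close> and \<open>X\<close>.

  Let \<open>Y\<close> have the same \<open>\<mu>\<close> and \<open>\<delta>\<close> and a scale matrix \<open>\<Omega>'\<close> with \<open>\<Omega>' - \<Omega>\<close> positive semidefinite. Then \<open>\<Omega> - \<delta> \<delta>\<^sup>T\<close> and
  \<open>\<Omega>' - \<delta> \<delta>\<^sup>T\<close> are positive definite with the same difference, and they can be diagonalised simultaneously: \<open>Y\<close> has the
  law of \<open>\<mu> + U \<delta> + C S V\<close> with a diagonal matrix \<open>S\<close> whose entries are at least 1 (\<open>simultaneous_diagonalisation\<close>). So it
  suffices to show that dilating the coordinates of a standard Gaussian vector increases the expectation of every convex
  function (\<open>gauss_dilation_convex\<close>). Choose random signs with means \<open>1 / S\<^sub>i\<^sub>i\<close>. Then \<open>V\<close> is the average of \<open>S \<epsilon> V\<close>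
  over the sign vectors \<open>\<epsilon>\<close>, Jensen's inequality bounds \<open>f V\<close> by the average of \<open>f (S \<epsilon> V)\<close>, and \<open>\<epsilon> V\<close> has the law of
  \<open>V\<close>. Positive and negative parts are kept on the appropriate sides of the inequality throughout, so that infinite
  expectations need no separate treatment.

  Conversely, the linear functions and their negatives are convex, so the convex order fixes the mean, and \<open>E X - \<mu>\<close> is
  \<open>\<delta>\<close> times the positive mean of \<open>U\<close>. The functions \<open>(a \<bullet> (x - \<mu>))\<^sup>2\<close> are convex and have expectation \<open>a \<bullet> \<Omega> a\<close>,
  which compares the scale matrices (\<open>skew_normal_convex_order_imp\<close>).

  The statements for matrices follow since \<open>vectorize\<close> is a linear bijection and hence preserves the convex order in
  both directions.
\<close>

section \<open>Diagonalisation of symmetric matrices\<close>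

text \<open>
  The first variation of the Rayleigh quotient at a maximiser \<open>v\<close> vanishes. It is taken in the direction of
  the residual \<open>w = T v - (v \<bullet> T v) v\<close> itself, along which it equals \<open>2 (w \<bullet> w)\<close>; hence \<open>w = 0\<close>.
\<close>

lemma rayleigh_maximiser_eigenvector:
  fixes T :: "'a::euclidean_space \<Rightarrow> 'a"
  assumes "linear T" and sa: "\<And>x y. T x \<bullet> y = x \<bullet> T y"
    and S: "subspace S" "T ` S \<subseteq> S" and v: "v \<in> S" "norm v = 1"
    and max: "\<And>x. x \<in> S \<Longrightarrow> norm x = 1 \<Longrightarrow> x \<bullet> T x \<le> v \<bullet> T v"
  shows "T v = (v \<bullet> T v) *\<^sub>R v"
proof -
  interpret T: linear T by fact
  define l where "l = v \<bullet> T v"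
  have vv: "v \<bullet> v = 1" using v by (simp add: dot_square_norm)
  have bound: "x \<bullet> T x \<le> l * (x \<bullet> x)" if "x \<in> S" for x
  proof (cases "x = 0")
    case False
    have "inverse (norm x) *\<^sub>R x \<in> S" using S that by (simp add: subspace_scale)
    from max[OF this] False have "(x \<bullet> T x) / (norm x)\<^sup>2 \<le> l"
      by (simp add: l_def T.scale divide_inverse power2_eq_square mult_ac)
    then show ?thesis using False
      by (simp add: pos_divide_le_eq power2_norm_eq_inner)
  qed (simp add: T.zero)
  define w where "w = T v - l *\<^sub>R v"
  have wS: "w \<in> S" using S v by (auto simp: w_def intro!: subspace_diff subspace_scale)
  have wv: "w \<bullet> v = 0" by (simp add: w_def inner_diff_left vv l_def inner_commute[of "T v"])
  have wT: "w \<bullet> T v = w \<bullet> w"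
  proof -
    have "T v = w + l *\<^sub>R v" by (simp add: w_def)
    then show ?thesis using wv by (simp add: inner_add_right)
  qed
  define k where "k = l * (w \<bullet> w) - w \<bullet> T w"
  have quad: "2 * t * (w \<bullet> w) \<le> t\<^sup>2 * k" for t
  proof -
    have "v + t *\<^sub>R w \<in> S" using S v wS by (simp add: subspace_add subspace_scale)
    from bound[OF this] have b: "(v + t *\<^sub>R w) \<bullet> T (v + t *\<^sub>R w)
        \<le> l * ((v + t *\<^sub>R w) \<bullet> (v + t *\<^sub>R w))" .
    have vw: "v \<bullet> w = 0" using wv by (simp add: inner_commute)
    have vTw: "v \<bullet> T w = w \<bullet> w" using sa[of v w] wT by (simp add: inner_commute)
    have "(v + t *\<^sub>R w) \<bullet> T (v + t *\<^sub>R w) = l + 2 * t * (w \<bullet> w) + t\<^sup>2 * (w \<bullet> T w)"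
      by (simp add: T.add T.scale inner_add_left inner_add_right vTw wT flip: l_def)
        (simp add: algebra_simps power2_eq_square)
    moreover have "(v + t *\<^sub>R w) \<bullet> (v + t *\<^sub>R w) = 1 + t\<^sup>2 * (w \<bullet> w)"
      by (simp add: inner_add_left inner_add_right vv vw wv power2_eq_square)
    ultimately show ?thesis using b unfolding k_def by (simp add: algebra_simps)
  qed
  have "w \<bullet> w = 0"
  proof (rule ccontr)
    assume "w \<bullet> w \<noteq> 0"
    then have pos: "w \<bullet> w > 0" by (metis inner_eq_zero_iff inner_gt_zero_iff)
    \<comment> \<open>A step so short that the linear term in \<open>quad\<close> beats the quadratic one.\<close>
    define t where "t = (w \<bullet> w) / (\<bar>k\<bar> + 1)"
    have tp: "t > 0" unfolding t_def using pos by simp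
    have "t * k \<le> t * (\<bar>k\<bar> + 1)" using tp by (intro mult_left_mono) auto
    also have "\<dots> = w \<bullet> w" unfolding t_def by simp
    finally have "t * (t * k) \<le> t * (w \<bullet> w)" using tp by simp
    moreover have "t * (w \<bullet> w) > 0" using tp pos by simp
    ultimately show False using quad[of t] by (simp add: power2_eq_square mult.assoc)
  qed
  then show ?thesis by (simp add: w_def l_def)
qed

text \<open>
  Induction on the dimension: a unit vector of \<open>S\<close> maximising the Rayleigh quotient is an eigenvector, and its
  orthogonal complement in \<open>S\<close> is again invariant.
\<close>

lemma self_adjoint_eigenbasis:
  fixes T :: "'a::euclidean_space \<Rightarrow> 'a"
  assumes "linear T" and sa: "\<And>x y. T x \<bullet> y = x \<bullet> T y"
    and "subspace S" "T ` S \<subseteq> S"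
  shows "\<exists>B\<subseteq>S. pairwise orthogonal B \<and> (\<forall>x\<in>B. norm x = 1 \<and> (\<exists>c. T x = c *\<^sub>R x)) \<and> span B = S"
  using assms(3,4)
proof (induction "dim S" arbitrary: S)
  case 0
  then have "S = {0}" using subspace_0 by (auto simp: dim_eq_0)
  then show ?case by (intro exI[of _ "{}"]) auto
next
  case (Suc n)
  interpret T: linear T by fact
  have "S \<noteq> {0}" using Suc.hyps(2) by auto
  then obtain a where a: "a \<in> S" "a \<noteq> 0" using Suc.prems(1) subspace_0 by blast
  have "compact (S \<inter> sphere 0 1)"
    using closed_subspace[OF Suc.prems(1)] by (simp add: closed_Int_compact)
  moreover have "inverse (norm a) *\<^sub>R a \<in> S \<inter> sphere 0 1"
    using a Suc.prems(1) by (simp add: subspace_scale)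
  moreover have "continuous_on (S \<inter> sphere 0 1) (\<lambda>x. x \<bullet> T x)"
    by (intro continuous_intros linear_continuous_on linear_conv_bounded_linear[THEN iffD1] assms(1))
  ultimately obtain v where v: "v \<in> S \<inter> sphere 0 1"
      and vmax: "\<forall>y\<in>S \<inter> sphere 0 1. y \<bullet> T y \<le> v \<bullet> T v"
    using continuous_attains_sup[of "S \<inter> sphere 0 1" "\<lambda>x. x \<bullet> T x"] by blast
  have vn: "norm v = 1" and vS: "v \<in> S" using v by auto
  have eig: "T v = (v \<bullet> T v) *\<^sub>R v"
    by (rule rayleigh_maximiser_eigenvector[OF assms(1) sa Suc.prems vS vn]) (use vmax in auto)
  have vv: "v \<bullet> v = 1" using vn by (simp add: dot_square_norm)
  define S' where "S' = S \<inter> {x. v \<bullet> x = 0}"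
  have S': "subspace S'" unfolding S'_def
    using Suc.prems(1) subspace_hyperplane by (rule subspace_inter)
  have TS': "T ` S' \<subseteq> S'"
  proof clarify
    fix x assume x: "x \<in> S'"
    have "v \<bullet> T x = (v \<bullet> T v) * (v \<bullet> x)" by (metis eig inner_scaleR_left sa)
    with x Suc.prems(2) show "T x \<in> S'" unfolding S'_def by auto
  qed
  have spanS: "span (insert v S') = S"
  proof
    show "span (insert v S') \<subseteq> S" using vS Suc.prems(1) by (intro span_minimal) (auto simp: S'_def)
    show "S \<subseteq> span (insert v S')"
    proof
      fix x assume x: "x \<in> S"
      have "x - (v \<bullet> x) *\<^sub>R v \<in> S'" unfolding S'_def using x vS Suc.prems(1) vv
        by (auto intro!: subspace_diff subspace_scale simp: inner_diff_right)
      then have "x - (v \<bullet> x) *\<^sub>R v \<in> span (insert v S')" by (simp add: span_base)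
      moreover have "(v \<bullet> x) *\<^sub>R v \<in> span (insert v S')" by (simp add: span_base span_scale)
      ultimately show "x \<in> span (insert v S')" by (metis diff_add_cancel span_add)
    qed
  qed
  have "v \<notin> span S'" using vv S' by (auto simp: S'_def span_eq_iff[THEN iffD2])
  then have "dim S = Suc (dim S')"
    using dim_insert[of v S'] dim_span[of "insert v S'"] spanS by auto
  then have "n = dim S'" using Suc.hyps(2) by simp
  from Suc.hyps(1)[OF this S' TS'] obtain B where B: "B \<subseteq> S'" "pairwise orthogonal B"
    "\<forall>x\<in>B. norm x = 1 \<and> (\<exists>c. T x = c *\<^sub>R x)" "span B = S'" by blast
  show ?case
  proof (intro exI[of _ "insert v B"] conjI)
    show "insert v B \<subseteq> S" using B vS by (auto simp: S'_def)
    show "pairwise orthogonal (insert v B)"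
      using B by (auto simp: pairwise_insert S'_def orthogonal_def inner_commute)
    show "\<forall>x\<in>insert v B. norm x = 1 \<and> (\<exists>c. T x = c *\<^sub>R x)" using B vn eig by blast
    show "span (insert v B) = S"
      unfolding spanS[symmetric] span_insert B(4) using S' by (simp add: span_eq_iff[THEN iffD2])
  qed
qed

definition diagonal :: "('m \<Rightarrow> real) \<Rightarrow> real^'m^'m" where
  "diagonal d = (\<chi> i j. if i = j then d i else 0)"

lemma diagonal_mult_vec: "diagonal d *v x = (\<chi> i. d i * x $ i)"
  by (simp add: diagonal_def matrix_vector_mult_def vec_eq_iff if_distrib[of "\<lambda>a. a * _"] cong: if_cong)

lemma diagonal_mult_diagonal: "diagonal d ** diagonal e = diagonal (\<lambda>i. d i * e i)"
  by (simp add: matrix_eq diagonal_mult_vec matrix_vector_mul_assoc[symmetric] mult.assoc)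

lemma transpose_diagonal: "transpose (diagonal d) = diagonal d"
  by (auto simp: diagonal_def transpose_def vec_eq_iff)

lemma symmetric_matrix_diagonalisation:
  fixes S :: "real^'m^'m"
  assumes sym: "transpose S = S"
  shows "\<exists>R d. orthogonal_matrix R \<and> S = R ** diagonal d ** transpose R"
proof -
  have sa: "(S *v x) \<bullet> y = x \<bullet> (S *v y)" for x y
    using sym by (metis dot_lmul_matrix vector_transpose_matrix)
  obtain B :: "(real^'m) set" where B: "pairwise orthogonal B"
    "\<forall>x\<in>B. norm x = 1 \<and> (\<exists>c. S *v x = c *\<^sub>R x)" "span B = UNIV"
    using self_adjoint_eigenbasis[OF matrix_vector_mul_linear[of S] sa, of UNIV] by auto
  have ind: "independent B" using B by (intro pairwise_orthogonal_independent) auto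
  then have fin: "finite B" by (rule independent_imp_finite)
  have "card B = CARD('m)" using dim_eq_card[of B UNIV] ind B(3) by simp
  then obtain b where b: "bij_betw b (UNIV :: 'm set) B"
    using fin by (metis finite_same_card_bij finite)
  define d where "d i = (SOME c. S *v b i = c *\<^sub>R b i)" for i
  have bB: "b i \<in> B" for i using b by (auto simp: bij_betw_def)
  have d: "S *v b i = d i *\<^sub>R b i" for i
    unfolding d_def using B(2) bB[of i] by (metis (mono_tags, lifting) someI_ex)
  define R :: "real^'m^'m" where "R = (\<chi> i j. b j $ i)"
  have col: "column j R = b j" for j by (simp add: R_def column_def vec_eq_iff)
  have inj: "b i \<noteq> b j" if "i \<noteq> j" for i j using b that by (auto simp: bij_betw_def inj_on_def)
  have R: "orthogonal_matrix R"
    unfolding orthogonal_matrix_orthonormal_columns col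
    using B(1,2) bB inj by (auto simp: pairwise_def)
  have "S ** R = R ** diagonal d"
  proof (simp add: vec_eq_iff, intro allI)
    fix i j
    have "(S ** R) $ i $ j = (S *v b j) $ i"
      by (simp add: matrix_matrix_mult_def matrix_vector_mult_def R_def)
    also have "\<dots> = (R ** diagonal d) $ i $ j"
      unfolding d by (simp add: matrix_matrix_mult_def R_def diagonal_def mult.commute
          if_distrib[of "\<lambda>a. _ * a"] cong: if_cong)
    finally show "(S ** R) $ i $ j = (R ** diagonal d) $ i $ j" .
  qed
  then have "S = R ** diagonal d ** transpose R"
    using R by (metis matrix_mul_assoc matrix_mul_rid orthogonal_matrix orthogonal_matrix_def)
  with R show ?thesis by blast
qed

lemma dot_conjugate_mult_vec:
  fixes C :: "real^'k^'m"
  shows "x \<bullet> ((C ** D ** transpose C) *v x) = (transpose C *v x) \<bullet> (D *v (transpose C *v x))"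
  by (metis dot_lmul_matrix matrix_vector_mul_assoc transpose_matrix_vector)

lemma dot_diagonal_axis: "axis i 1 \<bullet> (diagonal d *v axis i 1) = (d i :: real)"
  by (simp add: diagonal_mult_vec inner_axis' )

lemma pos_def_square_root_factor:
  fixes \<Psi> :: "real^'m^'m"
  assumes "pos_def \<Psi>"
  shows "\<exists>A::real^'m^'m. \<Psi> = A ** transpose A \<and> invertible A"
proof -
  obtain R d where R: "orthogonal_matrix R" and \<Psi>: "\<Psi> = R ** diagonal d ** transpose R"
    using symmetric_matrix_diagonalisation assms unfolding pos_def_def by blast
  have RtR: "transpose R ** R = mat 1" using R by (simp add: orthogonal_matrix_def)
  have d: "d i > 0" for i
  proof -
    let ?x = "R *v axis i 1"
    have "transpose R *v ?x = axis i 1" by (simp add: matrix_vector_mul_assoc RtR)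
    then have e: "?x \<bullet> (\<Psi> *v ?x) = d i"
      unfolding \<Psi> dot_conjugate_mult_vec by (simp add: dot_diagonal_axis)
    have "?x \<noteq> 0" using \<open>transpose R *v ?x = axis i 1\<close> by (auto simp: axis_eq_0_iff)
    with assms e show ?thesis unfolding pos_def_def by metis
  qed
  define A where "A = R ** diagonal (\<lambda>i. sqrt (d i))"
  have "A ** transpose A = R ** (diagonal (\<lambda>i. sqrt (d i)) ** diagonal (\<lambda>i. sqrt (d i))) ** transpose R"
    by (simp add: A_def matrix_transpose_mul transpose_diagonal matrix_mul_assoc)
  also have "\<dots> = \<Psi>" using d by (simp add: diagonal_mult_diagonal \<Psi> less_imp_le)
  finally have AA: "A ** transpose A = \<Psi>" .
  have "invertible A"
  proof -
    have "diagonal (\<lambda>i. sqrt (d i)) ** diagonal (\<lambda>i. 1 / sqrt (d i)) = mat 1"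
      using d by (simp add: diagonal_mult_diagonal less_imp_neq[symmetric]) (simp add: diagonal_def mat_def)
    then have "A ** (diagonal (\<lambda>i. 1 / sqrt (d i)) ** transpose R) = mat 1"
      using R unfolding A_def orthogonal_matrix_def by (metis matrix_mul_assoc matrix_mul_rid)
    then show ?thesis by (auto simp: invertible_right_inverse)
  qed
  with AA show ?thesis by metis
qed

text \<open>
  If \<open>\<Psi> = A A\<^sup>T\<close>, an orthogonal \<open>R\<close> diagonalises \<open>A\<inverse> \<Psi>' A\<^sup>-\<^sup>T\<close>, and \<open>C = A R\<close> works for both matrices. In the
  coordinates given by \<open>C\<close> the difference \<open>\<Psi>' - \<Psi>\<close> is diagonal with entries \<open>(s i)\<^sup>2 - 1\<close>, so its semidefiniteness is
  the condition \<open>1 \<le> s i\<close>: a Gaussian vector with covariance \<open>\<Psi>'\<close> is a coordinatewise dilation of one with covariance \<open>\<Psi>\<close>.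
\<close>

lemma simultaneous_diagonalisation:
  fixes \<Psi> \<Psi>' :: "real^'m^'m"
  assumes "pos_def \<Psi>" "transpose \<Psi>' = \<Psi>'" "pos_semidef (\<Psi>' - \<Psi>)"
  shows "\<exists>(C::real^'m^'m) s. \<Psi> = C ** transpose C \<and> \<Psi>' = (C ** diagonal s) ** transpose (C ** diagonal s) \<and> (\<forall>i. s i \<ge> 1)"
proof -
  obtain A :: "real^'m^'m" where A: "\<Psi> = A ** transpose A" "invertible A"
    using pos_def_square_root_factor[OF assms(1)] by blast
  then obtain A' :: "real^'m^'m" where A': "A ** A' = mat 1" "A' ** A = mat 1" by (auto simp: invertible_def)
  define S where "S = A' ** \<Psi>' ** transpose A'"
  have tA: "transpose A' ** transpose A = mat 1" "transpose A ** transpose A' = mat 1"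
    using A' by (simp_all add: matrix_transpose_mul[symmetric] transpose_mat)
  have "transpose S = S" using assms(2) by (simp add: S_def matrix_transpose_mul matrix_mul_assoc)
  then obtain R d where R: "orthogonal_matrix R" and S: "S = R ** diagonal d ** transpose R"
    using symmetric_matrix_diagonalisation by blast
  have RR: "R ** transpose R = mat 1" "transpose R ** R = mat 1" using R by (auto simp: orthogonal_matrix_def)
  define C where "C = A ** R"
  have \<Psi>: "\<Psi> = C ** transpose C"
    unfolding C_def A(1) matrix_transpose_mul by (metis RR(1) matrix_mul_assoc matrix_mul_rid)
  have "A ** S ** transpose A = (A ** A') ** \<Psi>' ** (transpose A' ** transpose A)"
    by (simp add: S_def matrix_mul_assoc)
  then have "\<Psi>' = A ** S ** transpose A" using A' tA by simp
  then have \<Psi>': "\<Psi>' = C ** diagonal d ** transpose C" by (simp add: S C_def matrix_transpose_mul matrix_mul_assoc)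
  have d: "d i \<ge> 1" for i
  proof -
    let ?x = "transpose A' *v (R *v axis i 1)"
    have "transpose C ** (transpose A' ** R) = mat 1"
      unfolding C_def matrix_transpose_mul by (metis RR(2) tA(2) matrix_mul_assoc matrix_mul_rid)
    then have Cx: "transpose C *v ?x = axis i 1"
      by (simp add: matrix_vector_mul_assoc)
    have "?x \<bullet> (\<Psi> *v ?x) = 1" "?x \<bullet> (\<Psi>' *v ?x) = d i"
      using dot_conjugate_mult_vec[of ?x C "mat 1"] dot_conjugate_mult_vec[of ?x C "diagonal d"]
      unfolding \<Psi> \<Psi>' Cx by (simp_all add: dot_diagonal_axis inner_axis)
    moreover have "0 \<le> ?x \<bullet> ((\<Psi>' - \<Psi>) *v ?x)" using assms(3) by (simp add: pos_semidef_def)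
    ultimately show ?thesis by (simp add: matrix_vector_mult_diff_rdistrib inner_diff_right)
  qed
  define s where "s i = sqrt (d i)" for i
  have "s i \<ge> 1" for i using d[of i] by (simp add: s_def)
  moreover have "(C ** diagonal s) ** transpose (C ** diagonal s) = C ** (diagonal s ** diagonal s) ** transpose C"
    by (simp add: matrix_transpose_mul transpose_diagonal matrix_mul_assoc)
  moreover have "diagonal s ** diagonal s = diagonal d"
    using d by (simp add: diagonal_mult_diagonal s_def order_trans[OF zero_le_one])
  ultimately show ?thesis using \<Psi> \<Psi>' by metis
qed

section \<open>Standard Gaussian measure\<close>

lemma nn_integral_lborel_translate:
  fixes f :: "'a::euclidean_space \<Rightarrow> ennreal"
  assumes [measurable]: "f \<in> borel_measurable borel"
  shows "(\<integral>\<^sup>+x. f (c + x) \<partial>lborel) = (\<integral>\<^sup>+x. f x \<partial>lborel)"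
  by (subst (2) lborel_distr_plus[of c, symmetric]) (simp add: nn_integral_distr)

text \<open>
  The image of Lebesgue measure under a linear bijection is translation invariant, hence a multiple of Lebesgue
  measure. The proof is the usual uniqueness argument for invariant measures: inserting \<open>g (T x + y)\<close> for \<open>g y\<close>, exchanging the
  two integrations and translating back shows that \<open>\<integral>f (T x) dx \<cdot> \<integral>g\<close> is symmetric in \<open>f\<close> and \<open>g\<close>, up to a
  reflection of \<open>f\<close>; then \<open>g\<close> is taken to be the indicator of the unit cube. The value of the constant is left open,
  because wherever the lemma is applied the constant is determined by the total mass of a probability measure.
\<close>

lemma nn_integral_linear_change_of_variables:
  fixes T T' :: "'a::euclidean_space \<Rightarrow> 'a"
  assumes "linear T" and TT': "\<And>x. T (T' x) = x"
  shows "\<exists>c. \<forall>f\<in>borel_measurable borel. (\<integral>\<^sup>+x. f (T x) \<partial>lborel) = c * (\<integral>\<^sup>+x. f x \<partial>lborel)"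
proof -
  interpret T: linear T by fact
  have [measurable]: "T \<in> borel_measurable borel"
    using assms(1) by (intro borel_measurable_continuous_onI linear_continuous_on linear_conv_bounded_linear[THEN iffD1])
  have swap: "(\<integral>\<^sup>+x. f (T x) \<partial>lborel) * (\<integral>\<^sup>+y. g y \<partial>lborel) = (\<integral>\<^sup>+x. g (T x) \<partial>lborel) * (\<integral>\<^sup>+y. f (- y) \<partial>lborel)"
    if [measurable]: "f \<in> borel_measurable borel" "g \<in> borel_measurable borel" for f g :: "'a \<Rightarrow> ennreal"
  proof -
    have "(\<integral>\<^sup>+x. f (T x) \<partial>lborel) * (\<integral>\<^sup>+y. g y \<partial>lborel) = (\<integral>\<^sup>+x. f (T x) * (\<integral>\<^sup>+y. g y \<partial>lborel) \<partial>lborel)"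
      by (simp add: nn_integral_multc)
    also have "\<dots> = (\<integral>\<^sup>+x. (\<integral>\<^sup>+y. f (T x) * g (T x + y) \<partial>lborel) \<partial>lborel)"
      by (simp add: nn_integral_cmult nn_integral_lborel_translate)
    also have "\<dots> = (\<integral>\<^sup>+y. (\<integral>\<^sup>+x. f (T x) * g (T x + y) \<partial>lborel) \<partial>lborel)"
      by (rule lborel_pair.Fubini') measurable
    \<comment> \<open>The translation of \<open>x\<close> by \<open>- T' y\<close> moves the shift by \<open>y\<close> from \<open>g\<close> to \<open>f\<close>.\<close>
    also have "\<dots> = (\<integral>\<^sup>+y. (\<integral>\<^sup>+x. f (T (- T' y + x)) * g (T (- T' y + x) + y) \<partial>lborel) \<partial>lborel)"
      by (intro nn_integral_cong nn_integral_lborel_translate[symmetric]) measurable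
    also have "\<dots> = (\<integral>\<^sup>+y. (\<integral>\<^sup>+x. f (T x - y) * g (T x) \<partial>lborel) \<partial>lborel)"
      by (simp add: T.add T.neg T.diff TT')
    also have "\<dots> = (\<integral>\<^sup>+x. (\<integral>\<^sup>+y. f (T x - y) * g (T x) \<partial>lborel) \<partial>lborel)"
      by (rule lborel_pair.Fubini') measurable
    also have "\<dots> = (\<integral>\<^sup>+x. (\<integral>\<^sup>+y. f (T x - (T x + y)) * g (T x) \<partial>lborel) \<partial>lborel)"
      by (intro nn_integral_cong nn_integral_lborel_translate[symmetric]) measurable
    also have "\<dots> = (\<integral>\<^sup>+x. g (T x) \<partial>lborel) * (\<integral>\<^sup>+y. f (- y) \<partial>lborel)"
      by (simp add: nn_integral_multc mult.commute)
    finally show ?thesis .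
  qed
  let ?g = "indicator (box 0 One) :: 'a \<Rightarrow> ennreal"
  have g: "(\<integral>\<^sup>+y. ?g y \<partial>lborel) = 1" by (simp add: emeasure_lborel_box_eq inner_Basis)
  have refl: "(\<integral>\<^sup>+y. f (- y) \<partial>lborel) = (\<integral>\<^sup>+y. f y \<partial>lborel)" if [measurable]: "f \<in> borel_measurable borel" for f :: "'a \<Rightarrow> ennreal"
    by (subst (2) lborel_affine[of "-1" 0]) (simp_all add: nn_integral_density nn_integral_distr)
  show ?thesis
  proof (intro exI[of _ "\<integral>\<^sup>+x. ?g (T x) \<partial>lborel"] ballI)
    fix f :: "'a \<Rightarrow> ennreal" assume f[measurable]: "f \<in> borel_measurable borel"
    show "(\<integral>\<^sup>+x. f (T x) \<partial>lborel) = (\<integral>\<^sup>+x. ?g (T x) \<partial>lborel) * (\<integral>\<^sup>+x. f x \<partial>lborel)"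
      using swap[of f ?g] g refl[OF f] by simp
  qed
qed

definition gauss_density :: "'a::euclidean_space \<Rightarrow> real" where
  "gauss_density x = exp (- (x \<bullet> x) / 2) / sqrt (2 * pi) ^ DIM('a)"

definition gauss :: "'a::euclidean_space measure" where
  "gauss = density lborel (\<lambda>x. ennreal (gauss_density x))"

lemma gauss_density_nonneg [simp]: "0 \<le> gauss_density x"
  by (simp add: gauss_density_def)

lemma borel_measurable_gauss_density [measurable]:
  "(gauss_density :: 'a::euclidean_space \<Rightarrow> real) \<in> borel_measurable borel"
  unfolding gauss_density_def by measurable

lemma sets_gauss [simp, measurable_cong]: "sets gauss = sets borel"
  and space_gauss [simp]: "space gauss = UNIV"
  by (simp_all add: gauss_def)

lemma gauss_density_eq_prod:
  "gauss_density (x::'a::euclidean_space) = (\<Prod>b\<in>Basis. std_normal_density (x \<bullet> b))"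
proof -
  have "x \<bullet> x = (\<Sum>b\<in>Basis. (x \<bullet> b)\<^sup>2)"
    unfolding euclidean_inner[of x x] power2_eq_square ..
  then have "- (x \<bullet> x) / 2 = (\<Sum>b\<in>Basis. - (x \<bullet> b)\<^sup>2 / 2)"
    by (simp add: sum_negf flip: sum_divide_distrib)
  then have "exp (- (x \<bullet> x) / 2) = (\<Prod>b\<in>Basis. exp (- (x \<bullet> b)\<^sup>2 / 2))"
    by (simp only: exp_sum[OF finite_Basis])
  moreover have "(\<Prod>b\<in>(Basis::'a set). 1 / sqrt (2 * pi)) = 1 / sqrt (2 * pi) ^ DIM('a)"
    by (simp only: prod_constant power_one_over)
  ultimately show ?thesis
    unfolding gauss_density_def std_normal_density_def prod.distrib by simp
qed

lemma nn_integral_std_normal [simp]: "(\<integral>\<^sup>+x. ennreal (std_normal_density x) \<partial>lborel) = 1"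
  by (simp add: nn_integral_eq_integral)

lemma nn_integral_gauss_component:
  fixes b :: "'a::euclidean_space"
  assumes b: "b \<in> Basis" and [measurable]: "h \<in> borel_measurable borel"
  shows "(\<integral>\<^sup>+x. h (x \<bullet> b) \<partial>gauss) = (\<integral>\<^sup>+x. h x \<partial>std_normal_distribution)"
proof -
  let ?F = "\<lambda>c t. ennreal (std_normal_density t) * (if c = b then h t else 1)"
  have "(\<integral>\<^sup>+x. h (x \<bullet> b) \<partial>gauss) = (\<integral>\<^sup>+x. (\<Prod>c\<in>Basis. ?F c (x \<bullet> c)) \<partial>(lborel :: 'a measure))"
    unfolding gauss_def
    by (simp add: nn_integral_density gauss_density_eq_prod prod_ennreal[symmetric] prod.distrib b)
  also have "\<dots> = (\<Prod>c\<in>Basis. (\<integral>\<^sup>+t. ?F c t \<partial>lborel))"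
    by (rule nn_integral_lborel_prod) simp_all
  also have "\<dots> = (\<Prod>c\<in>Basis. if c = b then \<integral>\<^sup>+x. h x \<partial>std_normal_distribution else 1)"
    by (intro prod.cong refl) (simp add: nn_integral_density)
  finally show ?thesis by (simp add: b)
qed

lemma prob_space_std_normal: "prob_space std_normal_distribution"
  by (rule prob_space_normal_density) simp

lemma prob_space_gauss: "prob_space (gauss :: 'a::euclidean_space measure)"
proof
  obtain b :: 'a where "b \<in> Basis" using SOME_Basis by metis
  then have "(\<integral>\<^sup>+x. 1 \<partial>(gauss :: 'a measure)) = (\<integral>\<^sup>+x. 1 \<partial>std_normal_distribution)"
    using nn_integral_gauss_component[of b "\<lambda>_. 1"] by simp
  also have "\<dots> = 1" using prob_space.emeasure_space_1[OF prob_space_std_normal] by simp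
  finally show "emeasure (gauss :: 'a measure) (space gauss) = 1" by simp
qed

text \<open>
  The density is invariant under \<open>R\<close>, and the unknown constant in the change of variables is 1 because both sides
  integrate the function 1 to 1.
\<close>

lemma nn_integral_gauss_orthogonal:
  fixes R :: "'a::euclidean_space \<Rightarrow> 'a"
  assumes R: "orthogonal_transformation R" and [measurable]: "h \<in> borel_measurable borel"
  shows "(\<integral>\<^sup>+x. h (R x) \<partial>gauss) = (\<integral>\<^sup>+x. h x \<partial>gauss)"
proof -
  have lin: "linear R" using R by (rule orthogonal_transformation_linear)
  have [measurable]: "R \<in> borel_measurable borel"
    using lin by (intro borel_measurable_continuous_onI linear_continuous_on linear_conv_bounded_linear[THEN iffD1])
  have "R (inv R x) = x" for x using orthogonal_transformation_surj[OF R] by (rule surj_f_inv_f)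
  then obtain c where c: "\<forall>f\<in>borel_measurable borel. (\<integral>\<^sup>+x. f (R x) \<partial>lborel) = c * (\<integral>\<^sup>+x. f x \<partial>lborel)"
    using nn_integral_linear_change_of_variables[OF lin] by blast
  have dens: "gauss_density (R x) = gauss_density x" for x
    using R by (simp add: gauss_density_def orthogonal_transformation_def)
  have main: "(\<integral>\<^sup>+x. h (R x) \<partial>gauss) = c * (\<integral>\<^sup>+x. h x \<partial>gauss)" if [measurable]: "h \<in> borel_measurable borel" for h
    using c[rule_format, of "\<lambda>x. ennreal (gauss_density x) * h x"]
    unfolding gauss_def by (simp add: nn_integral_density dens)
  have "(\<integral>\<^sup>+x. 1 \<partial>(gauss :: 'a measure)) = 1" using prob_space.emeasure_space_1[OF prob_space_gauss] by simp
  with main[of "\<lambda>_. 1"] have "c = 1" by simp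
  with main show ?thesis by simp
qed

text \<open>
  By rotation invariance the direction of \<open>c\<close> may be taken to be a coordinate axis, along which the standard Gaussian
  is one-dimensional standard normal.
\<close>

lemma distr_gauss_inner:
  fixes c :: "real^'m"
  shows "distr gauss borel (\<lambda>x. c \<bullet> x) = distr std_normal_distribution borel (\<lambda>t. norm c * t)"
proof (rule measure_eqI)
  fix A :: "real set" assume "A \<in> sets (distr gauss borel (\<lambda>x. c \<bullet> x))"
  then have A [measurable]: "A \<in> sets borel" by simp
  have ind: "emeasure (distr M borel f) A = (\<integral>\<^sup>+x. indicator A (f x) \<partial>M)"
    if "f \<in> borel_measurable M" for M :: "'x measure" and f
    using nn_integral_distr[OF that, of "indicator A"] A by simp
  define k :: 'm where "k = undefined"
  have "norm (norm c *\<^sub>R axis k (1::real)) = norm c" by (simp add: norm_axis_1)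
  then obtain R :: "real^'m \<Rightarrow> real^'m" where R: "orthogonal_transformation R" "R (norm c *\<^sub>R axis k 1) = c"
    by (rule orthogonal_transformation_exists) blast
  have cR: "c \<bullet> R x = norm c * (x \<bullet> axis k 1)" for x
  proof -
    have "c \<bullet> R x = (norm c *\<^sub>R axis k 1) \<bullet> x"
      using R by (metis orthogonal_transformation_def)
    then show ?thesis by (simp add: inner_commute)
  qed
  have "emeasure (distr gauss borel (\<lambda>x. c \<bullet> x)) A = (\<integral>\<^sup>+x. indicator A (c \<bullet> x) \<partial>gauss)"
    by (rule ind) measurable
  also have "\<dots> = (\<integral>\<^sup>+x. indicator A (c \<bullet> R x) \<partial>gauss)"
    by (rule nn_integral_gauss_orthogonal[OF R(1), symmetric]) measurable
  also have "\<dots> = (\<integral>\<^sup>+x. indicator A (norm c * (x \<bullet> axis k 1)) \<partial>(gauss :: (real^'m) measure))"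
    by (simp only: cR)
  also have "\<dots> = (\<integral>\<^sup>+t. indicator A (norm c * t) \<partial>std_normal_distribution)"
    by (rule nn_integral_gauss_component[of _ "\<lambda>t. indicator A (norm c * t)"]) (auto simp: axis_in_Basis_iff)
  also have "\<dots> = emeasure (distr std_normal_distribution borel (\<lambda>t. norm c * t)) A"
    by (rule ind[symmetric]) measurable
  finally show "emeasure (distr gauss borel (\<lambda>x. c \<bullet> x)) A
      = emeasure (distr std_normal_distribution borel (\<lambda>t. norm c * t)) A" .
qed simp

lemma gauss_inner_moments:
  fixes c :: "real^'m"
  shows "integrable gauss (\<lambda>x. c \<bullet> x)" "integral\<^sup>L gauss (\<lambda>x. c \<bullet> x) = 0"
    and "integrable gauss (\<lambda>x. (c \<bullet> x)\<^sup>2)" "integral\<^sup>L gauss (\<lambda>x. (c \<bullet> x)\<^sup>2) = c \<bullet> c"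
proof -
  have m: "(\<lambda>x. c \<bullet> x) \<in> measurable gauss borel" by measurable
  have i1: "integrable std_normal_distribution (\<lambda>x. x)"
    using integrable_std_normal_distribution_moment[of 1] by simp
  have e1: "integral\<^sup>L std_normal_distribution (\<lambda>x. x) = 0"
    using integral_std_normal_distribution_moment_odd[of 1] by simp
  have i2: "integrable std_normal_distribution (\<lambda>x. x\<^sup>2)"
    by (rule integrable_std_normal_distribution_moment)
  have e2: "integral\<^sup>L std_normal_distribution (\<lambda>x. x\<^sup>2) = 1"
    using std_normal_distribution_even_moments(1)[of 1] by (simp add: fact_numeral)
  have transfer: "integrable gauss (\<lambda>x. h (c \<bullet> x)) \<longleftrightarrow> integrable std_normal_distribution (\<lambda>t. h (norm c * t))"
    "integral\<^sup>L gauss (\<lambda>x. h (c \<bullet> x)) = integral\<^sup>L std_normal_distribution (\<lambda>t. h (norm c * t))"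
    if h: "h \<in> borel_measurable borel" for h :: "real \<Rightarrow> real"
  proof -
    have m': "(\<lambda>t. norm c * t) \<in> measurable std_normal_distribution borel" by measurable
    show "integrable gauss (\<lambda>x. h (c \<bullet> x)) \<longleftrightarrow> integrable std_normal_distribution (\<lambda>t. h (norm c * t))"
      by (rule trans[OF integrable_distr_eq[OF m h, symmetric]])
        (simp only: distr_gauss_inner integrable_distr_eq[OF m' h])
    show "integral\<^sup>L gauss (\<lambda>x. h (c \<bullet> x)) = integral\<^sup>L std_normal_distribution (\<lambda>t. h (norm c * t))"
      by (rule trans[OF integral_distr[OF m h, symmetric]])
        (simp only: distr_gauss_inner integral_distr[OF m' h])
  qed
  have h1: "(\<lambda>x. x) \<in> borel_measurable (borel :: real measure)"
    and h2: "(\<lambda>x. x\<^sup>2) \<in> borel_measurable (borel :: real measure)" by measurable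
  show "integrable gauss (\<lambda>x. c \<bullet> x)" "integral\<^sup>L gauss (\<lambda>x. c \<bullet> x) = 0"
    unfolding transfer[of "\<lambda>x. x", OF h1]
    using i1 e1 by (auto intro: integrable_mult_right)
  show "integrable gauss (\<lambda>x. (c \<bullet> x)\<^sup>2)" "integral\<^sup>L gauss (\<lambda>x. (c \<bullet> x)\<^sup>2) = c \<bullet> c"
    unfolding transfer[of "\<lambda>x. x\<^sup>2", OF h2] power_mult_distrib
    using i2 e2 by (auto intro: integrable_mult_right simp: power2_norm_eq_inner)
qed

section \<open>Half-normal distribution\<close>

definition half_normal :: "real measure" where
  "half_normal = density lborel (\<lambda>u. ennreal (2 * std_normal_density u * indicator {0..} u))"

lemma sets_half_normal [simp, measurable_cong]: "sets half_normal = sets borel"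
  and space_half_normal [simp]: "space half_normal = UNIV"
  by (simp_all add: half_normal_def)

lemma nn_integral_half_normal_even:
  assumes [measurable]: "h \<in> borel_measurable borel" and even: "\<And>x. h (- x) = h x"
  shows "(\<integral>\<^sup>+u. h u \<partial>half_normal) = (\<integral>\<^sup>+x. h x \<partial>std_normal_distribution)"
proof -
  let ?n = "\<lambda>x. ennreal (std_normal_density x)"
  have pos: "(\<integral>\<^sup>+x. ?n x * h x * indicator {0..} x \<partial>lborel) = (\<integral>\<^sup>+x. ?n x * h x * indicator {..0} x \<partial>lborel)"
  proof -
    have "(\<integral>\<^sup>+x. ?n x * h x * indicator {0..} x \<partial>lborel)
        = (\<integral>\<^sup>+x. ?n (- x) * h (- x) * indicator {0..} (- x) \<partial>lborel)"
      using nn_integral_real_affine[of "\<lambda>x. ?n x * h x * indicator {0..} x" "-1" 0]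
      by (simp del: normal_density_nonneg)
    also have "\<dots> = (\<integral>\<^sup>+x. ?n x * h x * indicator {..0} x \<partial>lborel)"
      unfolding even std_normal_density_def by (intro nn_integral_cong) (simp add: indicator_def)
    finally show ?thesis .
  qed
  have "(\<integral>\<^sup>+x. h x \<partial>std_normal_distribution) = (\<integral>\<^sup>+x. ?n x * h x \<partial>lborel)"
    by (rule nn_integral_density) measurable
  also have "\<dots> = (\<integral>\<^sup>+x. ?n x * h x * indicator {0..} x + ?n x * h x * indicator {..0} x \<partial>lborel)"
    using AE_lborel_singleton[of "0::real"]
    by (intro nn_integral_cong_AE) (auto elim!: eventually_mono simp: indicator_def)
  also have "\<dots> = 2 * (\<integral>\<^sup>+x. ?n x * h x * indicator {0..} x \<partial>lborel)"
    by (subst nn_integral_add) (simp_all add: pos mult_2)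
  also have "\<dots> = (\<integral>\<^sup>+u. h u \<partial>half_normal)"
    unfolding half_normal_def
    by (subst nn_integral_density)
      (auto simp: nn_integral_cmult[symmetric] ennreal_mult indicator_def mult_ac intro!: nn_integral_cong)
  finally show ?thesis ..
qed

lemma prob_space_half_normal: "prob_space half_normal"
proof
  have "(\<integral>\<^sup>+x. 1 \<partial>half_normal) = (\<integral>\<^sup>+x. 1 \<partial>std_normal_distribution)"
    by (rule nn_integral_half_normal_even) auto
  also have "\<dots> = 1" using prob_space.emeasure_space_1[OF prob_space_std_normal] by simp
  finally show "emeasure half_normal (space half_normal) = 1" by simp
qed

lemma AE_half_normal_nonneg: "AE u in half_normal. 0 \<le> u"
  unfolding half_normal_def by (subst AE_density) (auto simp: indicator_def)

lemma half_normal_second_moment: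
  "integrable half_normal (\<lambda>u. u\<^sup>2)" "integral\<^sup>L half_normal (\<lambda>u. u\<^sup>2) = 1"
proof -
  have "(\<integral>\<^sup>+u. ennreal (u\<^sup>2) \<partial>half_normal) = (\<integral>\<^sup>+x. ennreal (x\<^sup>2) \<partial>std_normal_distribution)"
    by (rule nn_integral_half_normal_even) auto
  also have "\<dots> = ennreal 1"
    using std_normal_distribution_even_moments[of 1]
    by (subst nn_integral_eq_integral) (simp_all add: fact_numeral)
  finally have "has_bochner_integral half_normal (\<lambda>u. u\<^sup>2) 1"
    by (intro has_bochner_integral_nn_integral) auto
  then show "integrable half_normal (\<lambda>u. u\<^sup>2)" "integral\<^sup>L half_normal (\<lambda>u. u\<^sup>2) = 1"
    by (auto simp: has_bochner_integral_iff)
qed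

text \<open>
  This mean is the factor between the parameter \<open>\<delta>\<close> and the mean of a centred skew-normal vector; positivity allows
  it to be cancelled.
\<close>

lemma half_normal_mean:
  "integrable half_normal (\<lambda>u. u)" "0 < integral\<^sup>L half_normal (\<lambda>u. u)"
proof -
  interpret prob_space half_normal by (rule prob_space_half_normal)
  show i: "integrable half_normal (\<lambda>u. u)"
    by (rule square_integrable_imp_integrable) (simp_all add: half_normal_second_moment)
  have "integral\<^sup>L half_normal (\<lambda>u. u) \<noteq> 0"
  proof
    assume "integral\<^sup>L half_normal (\<lambda>u. u) = 0"
    then have "AE u in half_normal. u = 0"
      using integral_nonneg_eq_0_iff_AE[OF i AE_half_normal_nonneg] by simp
    then have "integral\<^sup>L half_normal (\<lambda>u. u\<^sup>2) = integral\<^sup>L half_normal (\<lambda>u. 0)"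
      by (intro integral_cong_AE) auto
    then show False by (simp add: half_normal_second_moment)
  qed
  moreover have "0 \<le> integral\<^sup>L half_normal (\<lambda>u. u)"
    by (rule integral_nonneg_AE[OF AE_half_normal_nonneg])
  ultimately show "0 < integral\<^sup>L half_normal (\<lambda>u. u)" by simp
qed

section \<open>Stochastic representation of the skew-normal law\<close>

lemma borel_measurable_matrix_vector_mult [measurable (raw)]:
  fixes A :: "real^'m^'k"
  assumes "f \<in> borel_measurable M"
  shows "(\<lambda>x. A *v f x) \<in> borel_measurable M"
  by (rule measurable_compose[OF assms])
    (intro borel_measurable_continuous_onI linear_continuous_on linear_conv_bounded_linear[THEN iffD1]
      matrix_vector_mul_linear)

definition outer_square :: "real^'m \<Rightarrow> real^'m^'m" where
  "outer_square \<delta> = (\<chi> i j. \<delta> $ i * \<delta> $ j)"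

lemma outer_square_mult_vec: "outer_square \<delta> *v x = (\<delta> \<bullet> x) *\<^sub>R \<delta>"
  by (simp add: outer_square_def matrix_vector_mult_def inner_vec_def vec_eq_iff sum_distrib_left
      sum_distrib_right mult_ac)

lemma symmetric_matrix_self_adjoint:
  fixes A :: "real^'m^'m"
  assumes "transpose A = A"
  shows "(A *v x) \<bullet> y = x \<bullet> (A *v y)"
  using assms by (metis dot_lmul_matrix vector_transpose_matrix)

lemma pos_def_inverse:
  assumes "pos_def \<Omega>"
  shows "\<Omega> *v (matrix_inv \<Omega> *v x) = x" "matrix_inv \<Omega> *v (\<Omega> *v x) = x"
    and "(matrix_inv \<Omega> *v x) \<bullet> y = x \<bullet> (matrix_inv \<Omega> *v y)"
proof -
  have "x = 0" if "\<Omega> *v x = 0" for x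
    using assms that unfolding pos_def_def by (metis inner_zero_right less_irrefl)
  then have "invertible \<Omega>"
    by (simp add: invertible_left_inverse matrix_left_invertible_ker)
  then have "\<Omega> ** matrix_inv \<Omega> = mat 1" "matrix_inv \<Omega> ** \<Omega> = mat 1"
    unfolding invertible_def matrix_inv_def by (auto intro: someI2_ex)
  then show 1: "\<Omega> *v (matrix_inv \<Omega> *v x) = x" "matrix_inv \<Omega> *v (\<Omega> *v x) = x" for x
    by (simp_all add: matrix_vector_mul_assoc)
  have "transpose \<Omega> = \<Omega>" using assms by (simp add: pos_def_def)
  from symmetric_matrix_self_adjoint[OF this, of "matrix_inv \<Omega> *v x" "matrix_inv \<Omega> *v y"]
  show "(matrix_inv \<Omega> *v x) \<bullet> y = x \<bullet> (matrix_inv \<Omega> *v y)" by (simp add: 1)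
qed

lemma pos_def_det_nonneg:
  fixes \<Omega> :: "real^'m^'m"
  assumes "pos_def \<Omega>" shows "0 \<le> det \<Omega>"
proof -
  obtain A :: "real^'m^'m" where "\<Omega> = A ** transpose A"
    using pos_def_square_root_factor[OF assms] by blast
  then have "det \<Omega> = (det A)\<^sup>2" by (simp add: det_mul det_transpose power2_eq_square)
  then show ?thesis by simp
qed

text \<open>
  In the inner product given by \<open>\<Omega>\<close>, \<open>\<delta> \<bullet> x\<close> is the product of \<open>\<Omega>\<inverse> \<delta>\<close> and \<open>x\<close>, and admissibility says that \<open>\<Omega>\<inverse> \<delta>\<close> has norm less
  than 1; so this is the Cauchy-Schwarz inequality \<open>(\<delta> \<bullet> x)\<^sup>2 \<le> q (x \<bullet> \<Omega> x)\<close> with \<open>q < 1\<close>.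
\<close>

lemma pos_def_minus_outer_square:
  assumes \<Omega>: "pos_def \<Omega>" and q: "admissible_delta \<Omega> \<delta>"
  shows "pos_def (\<Omega> - outer_square \<delta>)"
  unfolding pos_def_def
proof (intro conjI allI impI)
  have sym: "transpose \<Omega> = \<Omega>" using \<Omega> by (simp add: pos_def_def)
  show "transpose (\<Omega> - outer_square \<delta>) = \<Omega> - outer_square \<delta>"
    using sym by (simp add: outer_square_def transpose_def vec_eq_iff mult.commute)
  fix x :: "real^'a" assume x: "x \<noteq> 0"
  let ?w = "matrix_inv \<Omega> *v \<delta>"
  define t where "t = \<delta> \<bullet> x"
  define q where "q = \<delta> \<bullet> ?w"
  have q1: "q < 1" using assms by (simp add: admissible_delta_def q_def)
  have "?w \<bullet> (\<Omega> *v x) = t"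
    by (simp add: t_def symmetric_matrix_self_adjoint[OF sym, symmetric] pos_def_inverse[OF \<Omega>])
  then have "(x - t *\<^sub>R ?w) \<bullet> (\<Omega> *v (x - t *\<^sub>R ?w)) = x \<bullet> (\<Omega> *v x) - 2 * t\<^sup>2 + t\<^sup>2 * q"
    by (simp add: matrix_vector_mult_diff_distrib matrix_vector_mult_scaleR pos_def_inverse[OF \<Omega>] inner_diff_left
        inner_diff_right q_def inner_commute[of x \<delta>] inner_commute[of ?w \<delta>] flip: t_def)
      (simp add: power2_eq_square algebra_simps)
  moreover have "0 \<le> (x - t *\<^sub>R ?w) \<bullet> (\<Omega> *v (x - t *\<^sub>R ?w))"
    using \<Omega> unfolding pos_def_def by (cases "x - t *\<^sub>R ?w = 0") (auto intro: less_imp_le)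
  ultimately have ge: "x \<bullet> (\<Omega> *v x) - t\<^sup>2 \<ge> t\<^sup>2 * (1 - q)" by (simp add: algebra_simps)
  have form: "x \<bullet> ((\<Omega> - outer_square \<delta>) *v x) = x \<bullet> (\<Omega> *v x) - t\<^sup>2"
    by (simp add: matrix_vector_mult_diff_rdistrib outer_square_mult_vec inner_diff_right
        inner_commute[of x \<delta>] power2_eq_square flip: t_def)
  show "0 < x \<bullet> ((\<Omega> - outer_square \<delta>) *v x)"
  proof (cases "t = 0")
    case True
    then show ?thesis using \<Omega> x form by (simp add: pos_def_def)
  next
    case False
    then have "0 < t\<^sup>2 * (1 - q)" using q1 by simp
    then show ?thesis using form ge by simp
  qed
qed

text \<open>
  The skewing factor is the mass of the half-line \<open>u \<ge> 0\<close> under a normal law with mean \<open>l\<close>: this mass makes \<open>u\<close> available as an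
  additional variable.
\<close>

lemma normal_cdf_eq_nn_integral:
  assumes s: "0 < s"
  shows "ennreal (cdf std_normal_distribution (l / s))
    = (\<integral>\<^sup>+u. ennreal (normal_density l s u * indicator {0..} u) \<partial>lborel)"
proof -
  interpret prob_space std_normal_distribution by (rule prob_space_std_normal)
  have "ennreal (cdf std_normal_distribution (l / s)) = emeasure std_normal_distribution {..l / s}"
    by (simp add: cdf_def emeasure_eq_measure)
  also have "\<dots> = (\<integral>\<^sup>+t. ennreal (std_normal_density t) * indicator {..l / s} t \<partial>lborel)"
    by (rule emeasure_density) auto
  also have "\<dots> = ennreal \<bar>- 1 / s\<bar> * (\<integral>\<^sup>+u. ennreal (std_normal_density (l / s + - 1 / s * u))
      * indicator {..l / s} (l / s + - 1 / s * u) \<partial>lborel)"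
    using s by (intro nn_integral_real_affine) auto
  also have "\<dots> = (\<integral>\<^sup>+u. ennreal \<bar>- 1 / s\<bar> * (ennreal (std_normal_density (l / s + - 1 / s * u))
      * indicator {..l / s} (l / s + - 1 / s * u)) \<partial>lborel)"
    by (rule nn_integral_cmult[symmetric]) measurable
  also have "\<dots> = (\<integral>\<^sup>+u. ennreal (normal_density l s u * indicator {0..} u) \<partial>lborel)"
  proof (rule nn_integral_cong)
    fix u
    have "\<bar>- 1 / s\<bar> * std_normal_density (l / s + - 1 / s * u) = normal_density l s u"
    proof -
      have "l / s + - 1 / s * u = - (u - l) / s" using s by (simp add: field_simps)
      then have "(l / s + - 1 / s * u)\<^sup>2 / 2 = (u - l)\<^sup>2 / (2 * s\<^sup>2)"
        by (simp only: power_divide power2_minus) simp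
      then show ?thesis using s
        by (simp add: normal_density_def real_sqrt_mult mult_ac)
    qed
    moreover have "l / s + - 1 / s * u \<le> l / s \<longleftrightarrow> 0 \<le> u"
      using s by (simp add: zero_le_divide_iff)
    ultimately show "ennreal \<bar>- 1 / s\<bar> * (ennreal (std_normal_density (l / s + - 1 / s * u))
      * indicator {..l / s} (l / s + - 1 / s * u)) = ennreal (normal_density l s u * indicator {0..} u)"
      by (cases "0 \<le> u") (simp_all add: indicator_def flip: ennreal_mult)
  qed
  finally show ?thesis .
qed

text \<open>
  By the Sherman-Morrison formula the inverse \<open>N\<close> of \<open>\<Omega> - \<delta> \<delta>\<^sup>T\<close> is \<open>\<Omega>\<inverse>\<close> plus a multiple of the square of \<open>\<Omega>\<inverse> \<delta>\<close>. Since
  \<open>C C\<^sup>T N = 1\<close>, the matrix \<open>D = C\<^sup>T N\<close> is the inverse of \<open>C\<close>, and the squared norm of \<open>D w\<close> is \<open>w \<bullet> N w\<close>.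
\<close>

lemma inverse_minus_outer_square:
  fixes \<Omega> C :: "real^'m^'m" and \<delta> :: "real^'m"
  defines "q \<equiv> \<delta> \<bullet> (matrix_inv \<Omega> *v \<delta>)"
  assumes \<Omega>: "pos_def \<Omega>" and q: "q < 1" and C: "C ** transpose C = \<Omega> - outer_square \<delta>"
  shows "\<exists>D. C ** D = mat 1 \<and> D ** C = mat 1 \<and>
    (\<forall>w. (D *v w) \<bullet> (D *v w) = w \<bullet> (matrix_inv \<Omega> *v w) + (\<delta> \<bullet> (matrix_inv \<Omega> *v w))\<^sup>2 / (1 - q))"
proof -
  let ?W = "matrix_inv \<Omega>"
  define N where "N = ?W + (1 / (1 - q)) *\<^sub>R outer_square (?W *v \<delta>)"
  define D where "D = transpose C ** N"
  have Nw: "N *v w = ?W *v w + ((\<delta> \<bullet> (?W *v w)) / (1 - q)) *\<^sub>R (?W *v \<delta>)" for w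
    by (simp add: N_def matrix_vector_mult_add_rdistrib scaleR_matrix_vector_assoc[symmetric] outer_square_mult_vec
        pos_def_inverse(3)[OF \<Omega>])
  have inv: "(C ** transpose C) *v (N *v w) = w" for w
  proof -
    define l where "l = \<delta> \<bullet> (?W *v w)"
    have "(C ** transpose C) *v (N *v w) = w + (l / (1 - q) - (l + l / (1 - q) * q)) *\<^sub>R \<delta>"
      unfolding C Nw
      by (simp add: matrix_vector_mult_diff_rdistrib matrix_vector_right_distrib matrix_vector_mult_scaleR
          pos_def_inverse(1)[OF \<Omega>] outer_square_mult_vec inner_add_right flip: l_def q_def)
        (simp add: algebra_simps)
    also have "l / (1 - q) - (l + l / (1 - q) * q) = 0" using q by (simp add: field_simps)
    finally show ?thesis by simp
  qed
  have "(C ** D) *v w = w" for w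
    using inv[of w] by (simp add: D_def matrix_vector_mul_assoc matrix_mul_assoc)
  then have CD: "C ** D = mat 1" by (simp add: matrix_eq)
  moreover from CD have "D ** C = mat 1" by (simp add: matrix_left_right_inverse)
  moreover have "(D *v w) \<bullet> (D *v w) = w \<bullet> (?W *v w) + (\<delta> \<bullet> (?W *v w))\<^sup>2 / (1 - q)" for w
  proof -
    have "(D *v w) \<bullet> (D *v w) = (transpose C *v (N *v w)) \<bullet> (transpose C *v (N *v w))"
      by (simp add: D_def matrix_vector_mul_assoc)
    also have "\<dots> = (N *v w) \<bullet> ((C ** transpose C) *v (N *v w))"
      using dot_conjugate_mult_vec[of "N *v w" C "mat 1"] by simp
    also have "\<dots> = (N *v w) \<bullet> w" by (simp add: inv)
    also have "\<dots> = w \<bullet> (?W *v w) + (\<delta> \<bullet> (?W *v w))\<^sup>2 / (1 - q)"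
      by (simp add: Nw inner_add_left pos_def_inverse(3)[OF \<Omega>] power2_eq_square)
    finally show ?thesis .
  qed
  ultimately show ?thesis by blast
qed

text \<open>
  Both sides are exponents of the joint law of \<open>(u, y)\<close>: on the left, \<open>y\<close> has covariance \<open>\<Omega>\<close> and \<open>u\<close> given \<open>y\<close> is normal; on the
  right, \<open>u\<close> is standard normal and \<open>y\<close> given \<open>u\<close> has mean \<open>u \<delta>\<close> and covariance \<open>\<Omega> - \<delta> \<delta>\<^sup>T\<close>.
\<close>

lemma skew_normal_complete_square:
  fixes \<Omega> D :: "real^'m^'m" and \<delta> :: "real^'m"
  defines "q \<equiv> \<delta> \<bullet> (matrix_inv \<Omega> *v \<delta>)"
  assumes \<Omega>: "pos_def \<Omega>" and q: "q < 1"
    and D: "\<And>w. (D *v w) \<bullet> (D *v w) = w \<bullet> (matrix_inv \<Omega> *v w) + (\<delta> \<bullet> (matrix_inv \<Omega> *v w))\<^sup>2 / (1 - q)"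
  shows "y \<bullet> (matrix_inv \<Omega> *v y) + (u - \<delta> \<bullet> (matrix_inv \<Omega> *v y))\<^sup>2 / (1 - q)
    = u\<^sup>2 + (D *v (y - u *\<^sub>R \<delta>)) \<bullet> (D *v (y - u *\<^sub>R \<delta>))"
proof -
  let ?W = "matrix_inv \<Omega>"
  define l where "l = \<delta> \<bullet> (?W *v y)"
  define a where "a = y \<bullet> (?W *v y)"
  have yl: "y \<bullet> (?W *v \<delta>) = l"
    unfolding l_def by (metis inner_commute pos_def_inverse(3)[OF \<Omega>])
  have "(y - u *\<^sub>R \<delta>) \<bullet> (?W *v (y - u *\<^sub>R \<delta>)) = a - 2 * u * l + u\<^sup>2 * q"
    by (simp add: matrix_vector_mult_diff_distrib matrix_vector_mult_scaleR inner_diff_left inner_diff_right yl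
        flip: l_def a_def q_def) (simp add: algebra_simps power2_eq_square)
  moreover have "\<delta> \<bullet> (?W *v (y - u *\<^sub>R \<delta>)) = l - u * q"
    by (simp add: matrix_vector_mult_diff_distrib matrix_vector_mult_scaleR inner_diff_right flip: l_def q_def)
  ultimately have R: "(D *v (y - u *\<^sub>R \<delta>)) \<bullet> (D *v (y - u *\<^sub>R \<delta>)) = a - 2 * u * l + u\<^sup>2 * q + (l - u * q)\<^sup>2 / (1 - q)"
    by (simp add: D)
  have "(u - l)\<^sup>2 = (u\<^sup>2 - 2 * u * l + u\<^sup>2 * q) * (1 - q) + (l - u * q)\<^sup>2" by (simp add: power2_eq_square algebra_simps)
  then have "(u - l)\<^sup>2 / (1 - q) = u\<^sup>2 - 2 * u * l + u\<^sup>2 * q + (l - u * q)\<^sup>2 / (1 - q)"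
    using q by (simp add: add_divide_distrib)
  then show ?thesis using R by (simp add: l_def a_def)
qed

text \<open>
  The density at \<open>z\<close> is an integral over \<open>u \<ge> 0\<close> of a joint density in \<open>(z, u)\<close>, which factors the other way round by the
  completed square. Exchanging the integrals and substituting \<open>z = \<mu> + u \<delta> + C v\<close> gives the claim up to a constant
  factor, which is 1 because both sides are integrals against probability measures. In particular no determinant has to be
  computed.
\<close>

lemma skew_normal_law_representation:
  fixes \<Omega> C :: "real^'m^'m" and \<mu> \<delta> :: "real^'m"
  defines "q \<equiv> \<delta> \<bullet> (matrix_inv \<Omega> *v \<delta>)"
  assumes P: "prob_space P"
    and dist: "distributed P lborel Z (\<lambda>z. ennreal (2 * mvn_density \<mu> \<Omega> z
        * cdf std_normal_distribution (\<delta> \<bullet> (matrix_inv \<Omega> *v (z - \<mu>)) / sqrt (1 - q))))"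
    and \<Omega>: "pos_def \<Omega>" and q: "q < 1" and C: "C ** transpose C = \<Omega> - outer_square \<delta>"
    and g: "g \<in> borel_measurable borel"
  shows "(\<integral>\<^sup>+\<xi>. g (Z \<xi>) \<partial>P) = (\<integral>\<^sup>+u. (\<integral>\<^sup>+v. g (\<mu> + u *\<^sub>R \<delta> + C *v v) \<partial>gauss) \<partial>half_normal)"
proof -
  obtain D where D: "C ** D = mat 1" "D ** C = mat 1"
    "\<And>w. (D *v w) \<bullet> (D *v w) = w \<bullet> (matrix_inv \<Omega> *v w) + (\<delta> \<bullet> (matrix_inv \<Omega> *v w))\<^sup>2 / (1 - q)"
    using inverse_minus_outer_square[where \<Omega>=\<Omega> and \<delta>=\<delta> and C=C] \<Omega> q C unfolding q_def by blast
  define s where "s = sqrt (1 - q)"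
  have s: "0 < s" "s\<^sup>2 = 1 - q" using q by (simp_all add: s_def)
  define l where "l z = \<delta> \<bullet> (matrix_inv \<Omega> *v (z - \<mu>))" for z
  have [measurable]: "l \<in> borel_measurable borel" unfolding l_def by measurable
  define k where "k = sqrt ((2 * pi) ^ CARD('m) * det \<Omega>)"
  have k: "0 \<le> k" using pos_def_det_nonneg[OF \<Omega>] by (simp add: k_def)
  \<comment> \<open>The ratio of the normalising constants of the two factorisations.\<close>
  define K where "K = sqrt (2 * pi) ^ CARD('m) * sqrt (2 * pi) / (k * sqrt (2 * pi * s\<^sup>2))"
  have K: "0 \<le> K" using k s(1) by (simp add: K_def)
  have joint: "mvn_density \<mu> \<Omega> z * normal_density (l z) s u
      = K * std_normal_density u * gauss_density (D *v (z - (\<mu> + u *\<^sub>R \<delta>)))" for z u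
  proof -
    have "(z - \<mu>) \<bullet> (matrix_inv \<Omega> *v (z - \<mu>)) + (u - l z)\<^sup>2 / s\<^sup>2
      = u\<^sup>2 + (D *v (z - (\<mu> + u *\<^sub>R \<delta>))) \<bullet> (D *v (z - (\<mu> + u *\<^sub>R \<delta>)))"
      using skew_normal_complete_square[where \<delta>=\<delta> and \<Omega>=\<Omega> and D=D and y="z - \<mu>" and u=u] \<Omega> q D(3)
      by (simp add: q_def l_def s(2) diff_diff_eq)
    then have "exp (- ((z - \<mu>) \<bullet> (matrix_inv \<Omega> *v (z - \<mu>))) / 2) * exp (- (u - l z)\<^sup>2 / (2 * s\<^sup>2))
      = exp (- u\<^sup>2 / 2) * exp (- ((D *v (z - (\<mu> + u *\<^sub>R \<delta>))) \<bullet> (D *v (z - (\<mu> + u *\<^sub>R \<delta>)))) / 2)"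
      unfolding exp_add[symmetric] by (intro arg_cong[where f=exp]) (simp add: field_simps)
    then show ?thesis
      by (simp add: mvn_density_def normal_density_def gauss_density_def K_def k_def)
  qed
  have nn: "mvn_density \<mu> \<Omega> z \<ge> 0" for z using k by (simp add: mvn_density_def k_def)
  define h where "h u = ennreal (2 * std_normal_density u * indicator {0..} u)" for u :: real
  have [measurable]: "h \<in> borel_measurable borel" unfolding h_def by measurable
  have DC: "D *v (C *v x) = x" "C *v (D *v x) = x" for x
    using D by (simp_all add: matrix_vector_mul_assoc)
  obtain c where c: "\<forall>f\<in>borel_measurable borel. (\<integral>\<^sup>+x. f (D *v x) \<partial>lborel) = c * (\<integral>\<^sup>+x. f x \<partial>lborel)"
    using nn_integral_linear_change_of_variables[OF matrix_vector_mul_linear DC(1)] by blast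
  have main: "(\<integral>\<^sup>+\<xi>. g (Z \<xi>) \<partial>P) = ennreal K * c * (\<integral>\<^sup>+u. (\<integral>\<^sup>+v. g (\<mu> + u *\<^sub>R \<delta> + C *v v) \<partial>gauss) \<partial>half_normal)"
    if g[measurable]: "g \<in> borel_measurable borel" for g
  proof -
    have "(\<integral>\<^sup>+\<xi>. g (Z \<xi>) \<partial>P) = (\<integral>\<^sup>+z. ennreal (2 * mvn_density \<mu> \<Omega> z
        * cdf std_normal_distribution (l z / s)) * g z \<partial>lborel)"
      using distributed_nn_integral[OF dist, of g] by (simp add: l_def s_def)
    also have "\<dots> = (\<integral>\<^sup>+z. (\<integral>\<^sup>+u. ennreal K * h u * ennreal (gauss_density (D *v (z - (\<mu> + u *\<^sub>R \<delta>)))) * g z \<partial>lborel) \<partial>lborel)"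
    proof (rule nn_integral_cong)
      fix z
      have "ennreal (2 * mvn_density \<mu> \<Omega> z * cdf std_normal_distribution (l z / s))
        = ennreal (2 * mvn_density \<mu> \<Omega> z) * (\<integral>\<^sup>+u. ennreal (normal_density (l z) s u * indicator {0..} u) \<partial>lborel)"
        unfolding normal_cdf_eq_nn_integral[OF s(1), symmetric]
        using nn[of z] by (intro ennreal_mult') simp
      also have "\<dots> = (\<integral>\<^sup>+u. ennreal (2 * mvn_density \<mu> \<Omega> z) * ennreal (normal_density (l z) s u * indicator {0..} u) \<partial>lborel)"
        by (rule nn_integral_cmult[symmetric]) measurable
      also have "\<dots> = (\<integral>\<^sup>+u. ennreal K * h u * ennreal (gauss_density (D *v (z - (\<mu> + u *\<^sub>R \<delta>)))) \<partial>lborel)"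
      proof (rule nn_integral_cong)
        fix u
        have "2 * mvn_density \<mu> \<Omega> z * (normal_density (l z) s u * indicator {0..} u)
          = K * (2 * std_normal_density u * indicator {0..} u) * gauss_density (D *v (z - (\<mu> + u *\<^sub>R \<delta>)))"
          using joint[of z u] by simp
        then show "ennreal (2 * mvn_density \<mu> \<Omega> z) * ennreal (normal_density (l z) s u * indicator {0..} u)
          = ennreal K * h u * ennreal (gauss_density (D *v (z - (\<mu> + u *\<^sub>R \<delta>))))"
          unfolding h_def using K nn[of z] by (simp flip: ennreal_mult ennreal_mult')
      qed
      finally show "ennreal (2 * mvn_density \<mu> \<Omega> z * cdf std_normal_distribution (l z / s)) * g z
        = (\<integral>\<^sup>+u. ennreal K * h u * ennreal (gauss_density (D *v (z - (\<mu> + u *\<^sub>R \<delta>)))) * g z \<partial>lborel)"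
        by (simp only: nn_integral_multc) (subst nn_integral_multc, measurable)
    qed
    also have "\<dots> = (\<integral>\<^sup>+u. (\<integral>\<^sup>+z. ennreal K * h u * ennreal (gauss_density (D *v (z - (\<mu> + u *\<^sub>R \<delta>)))) * g z \<partial>lborel) \<partial>lborel)"
      by (rule lborel_pair.Fubini') measurable
    also have "\<dots> = (\<integral>\<^sup>+u. ennreal K * h u * (c * (\<integral>\<^sup>+v. g (\<mu> + u *\<^sub>R \<delta> + C *v v) \<partial>gauss)) \<partial>lborel)"
    proof (rule nn_integral_cong)
      fix u
      let ?F = "\<lambda>v. ennreal (gauss_density v) * g (\<mu> + u *\<^sub>R \<delta> + C *v v)"
      have "(\<integral>\<^sup>+z. ennreal K * h u * ennreal (gauss_density (D *v (z - (\<mu> + u *\<^sub>R \<delta>)))) * g z \<partial>lborel)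
        = ennreal K * h u * (\<integral>\<^sup>+z. ennreal (gauss_density (D *v (z - (\<mu> + u *\<^sub>R \<delta>)))) * g z \<partial>lborel)"
        unfolding mult.assoc[of "ennreal K * h u"] by (rule nn_integral_cmult) measurable
      also have "(\<integral>\<^sup>+z. ennreal (gauss_density (D *v (z - (\<mu> + u *\<^sub>R \<delta>)))) * g z \<partial>lborel)
        = (\<integral>\<^sup>+w. ennreal (gauss_density (D *v ((\<mu> + u *\<^sub>R \<delta>) + w - (\<mu> + u *\<^sub>R \<delta>)))) * g ((\<mu> + u *\<^sub>R \<delta>) + w) \<partial>lborel)"
        by (rule nn_integral_lborel_translate[symmetric]) measurable
      also have "\<dots> = (\<integral>\<^sup>+w. ?F (D *v w) \<partial>lborel)" by (simp add: DC)
      also have "\<dots> = c * (\<integral>\<^sup>+v. ?F v \<partial>lborel)" by (rule c[rule_format]) measurable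
      also have "(\<integral>\<^sup>+v. ?F v \<partial>lborel) = (\<integral>\<^sup>+v. g (\<mu> + u *\<^sub>R \<delta> + C *v v) \<partial>gauss)"
        unfolding gauss_def by (rule nn_integral_density[symmetric]) measurable
      finally show "(\<integral>\<^sup>+z. ennreal K * h u * ennreal (gauss_density (D *v (z - (\<mu> + u *\<^sub>R \<delta>)))) * g z \<partial>lborel)
        = ennreal K * h u * (c * (\<integral>\<^sup>+v. g (\<mu> + u *\<^sub>R \<delta> + C *v v) \<partial>gauss))" .
    qed
    also have "\<dots> = (\<integral>\<^sup>+u. ennreal K * c * (h u * (\<integral>\<^sup>+v. g (\<mu> + u *\<^sub>R \<delta> + C *v v) \<partial>gauss)) \<partial>lborel)"
      by (simp only: mult_ac)
    also have "\<dots> = ennreal K * c * (\<integral>\<^sup>+u. h u * (\<integral>\<^sup>+v. g (\<mu> + u *\<^sub>R \<delta> + C *v v) \<partial>gauss) \<partial>lborel)"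
    proof -
      interpret prob_space "gauss :: (real^'m) measure" by (rule prob_space_gauss)
      show ?thesis by (rule nn_integral_cmult) measurable
    qed
    also have "(\<integral>\<^sup>+u. h u * (\<integral>\<^sup>+v. g (\<mu> + u *\<^sub>R \<delta> + C *v v) \<partial>gauss) \<partial>lborel)
      = (\<integral>\<^sup>+u. (\<integral>\<^sup>+v. g (\<mu> + u *\<^sub>R \<delta> + C *v v) \<partial>gauss) \<partial>half_normal)"
    proof -
      interpret prob_space "gauss :: (real^'m) measure" by (rule prob_space_gauss)
      show ?thesis unfolding half_normal_def h_def by (rule nn_integral_density[symmetric]) measurable
    qed
    finally show ?thesis .
  qed
  have "emeasure P (space P) = 1"
    and "emeasure (gauss :: (real^'m) measure) (space gauss) = 1"
    and "emeasure half_normal (space half_normal) = 1"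
    by (intro prob_space.emeasure_space_1 P prob_space_gauss prob_space_half_normal)+
  with main[of "\<lambda>_. 1"] have "ennreal K * c = 1" by simp
  with main[OF g] show ?thesis by simp
qed

section \<open>The two parametrisations\<close>

lemma pos_def_diagonal:
  assumes "\<And>i. 0 < d i"
  shows "pos_def (diagonal d)"
  unfolding pos_def_def
proof (intro conjI allI impI)
  fix x :: "real^'a" assume "x \<noteq> 0"
  then obtain i where i: "x $ i \<noteq> 0" by (auto simp: vec_eq_iff)
  have "0 < (\<Sum>j\<in>UNIV. d j * (x $ j)\<^sup>2)"
  proof (rule sum_pos2)
    show "0 < d i * (x $ i)\<^sup>2" using assms i by simp
  qed (simp_all add: assms less_imp_le)
  also have "\<dots> = x \<bullet> (diagonal d *v x)"
    by (simp add: inner_vec_def diagonal_mult_vec power2_eq_square mult_ac)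
  finally show "0 < x \<bullet> (diagonal d *v x)" .
qed (rule transpose_diagonal)

lemma pos_def_scale_diag:
  assumes "pos_def \<Omega>"
  shows "pos_def (scale_diag \<Omega>)"
proof -
  have "scale_diag \<Omega> = diagonal (\<lambda>i. sqrt (\<Omega> $ i $ i))" by (simp add: scale_diag_def diagonal_def)
  moreover have "0 < \<Omega> $ i $ i" for i
  proof -
    have "axis i 1 \<bullet> (\<Omega> *v axis i 1) = \<Omega> $ i $ i"
      by (simp add: inner_axis' matrix_vector_mul_component inner_axis)
    moreover have "axis i 1 \<noteq> (0 :: real^'a)" by (simp add: axis_eq_0_iff)
    ultimately show ?thesis using assms unfolding pos_def_def by metis
  qed
  ultimately show ?thesis by (simp add: pos_def_diagonal)
qed

lemma correlation_mult_vec: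
  "correlation \<Omega> *v x = matrix_inv (scale_diag \<Omega>) *v (\<Omega> *v (matrix_inv (scale_diag \<Omega>) *v x))"
  by (simp add: correlation_def matrix_vector_mul_assoc matrix_mul_assoc)

text \<open>
  With \<open>c\<close> as in the proof, \<open>\<Omega>\<inverse> \<delta>\<close> is \<open>c\<close> times \<open>\<alpha>\<close> in the unscaled coordinates, and \<open>1 - \<delta> \<bullet> \<Omega>\<inverse> \<delta> = c\<^sup>2\<close>, which is exactly the
  normalisation undone by \<open>alpha_of\<close>.
\<close>

lemma delta_of_inverse:
  fixes \<Omega> :: "real^'m^'m"
  assumes \<Omega>: "pos_def \<Omega>"
  shows "admissible_delta \<Omega> (delta_of \<Omega> \<alpha>)" "alpha_of \<Omega> (delta_of \<Omega> \<alpha>) = \<alpha>"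
proof -
  let ?E = "scale_diag \<Omega>" and ?F = "matrix_inv (scale_diag \<Omega>)" and ?W = "matrix_inv \<Omega>"
  note E = pos_def_inverse[OF pos_def_scale_diag[OF \<Omega>]]
  define s where "s = (?F *v \<alpha>) \<bullet> (\<Omega> *v (?F *v \<alpha>))"
  define c where "c = 1 / sqrt (1 + s)"
  have "0 \<le> s" using \<Omega> unfolding pos_def_def s_def by (cases "?F *v \<alpha> = 0") (auto intro: less_imp_le)
  then have c: "0 < c" "c\<^sup>2 = 1 / (1 + s)" "0 < 1 + s" by (simp_all add: c_def power_divide)
  have \<delta>: "delta_of \<Omega> \<alpha> = c *\<^sub>R (\<Omega> *v (?F *v \<alpha>))"
    by (simp add: delta_of_def correlation_mult_vec E(1) E(3)[symmetric] c_def s_def)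
  have W\<delta>: "?W *v delta_of \<Omega> \<alpha> = c *\<^sub>R (?F *v \<alpha>)"
    by (simp add: \<delta> matrix_vector_mult_scaleR pos_def_inverse[OF \<Omega>])
  have "delta_of \<Omega> \<alpha> \<bullet> (?W *v delta_of \<Omega> \<alpha>) = c\<^sup>2 * s"
    unfolding W\<delta> by (simp add: \<delta> s_def inner_commute power2_eq_square)
  moreover have "1 - c\<^sup>2 * s = c\<^sup>2" using c(3) unfolding c(2) by (simp add: field_simps)
  ultimately have q: "1 - delta_of \<Omega> \<alpha> \<bullet> (?W *v delta_of \<Omega> \<alpha>) = c\<^sup>2" by simp
  show "admissible_delta \<Omega> (delta_of \<Omega> \<alpha>)"
    using q c(1) zero_less_power[of c 2] unfolding admissible_delta_def by linarith
  show "alpha_of \<Omega> (delta_of \<Omega> \<alpha>) = \<alpha>"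
    unfolding alpha_of_def q unfolding W\<delta> using c(1) by (simp add: matrix_vector_mult_scaleR E(1))
qed

text \<open>
  Since \<open>\<delta>\<close> determines \<open>\<alpha>\<close>, all laws can be described by \<open>\<delta>\<close> alone.
\<close>

lemma skew_normal_imp_star:
  "skew_normal P Z \<mu> \<Omega> \<alpha> \<delta> \<Longrightarrow> skew_normal_star P Z \<mu> \<Omega> \<delta>"
  by (auto simp: skew_normal_def skew_normal_star_def has_skew_normal_law_def delta_of_inverse)

lemma inner_alpha_of:
  fixes \<Omega> :: "real^'m^'m"
  assumes \<Omega>: "pos_def \<Omega>"
  shows "alpha_of \<Omega> \<delta> \<bullet> (matrix_inv (scale_diag \<Omega>) *v y)
    = \<delta> \<bullet> (matrix_inv \<Omega> *v y) / sqrt (1 - \<delta> \<bullet> (matrix_inv \<Omega> *v \<delta>))"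
proof -
  note E = pos_def_inverse[OF pos_def_scale_diag[OF \<Omega>]]
  have "(scale_diag \<Omega> *v (matrix_inv \<Omega> *v \<delta>)) \<bullet> (matrix_inv (scale_diag \<Omega>) *v y) = \<delta> \<bullet> (matrix_inv \<Omega> *v y)"
    by (simp add: E(3)[symmetric] E(2) pos_def_inverse(3)[OF \<Omega>])
  then show ?thesis by (simp add: alpha_of_def)
qed

text \<open>
  The law is that of \<open>\<mu> + U \<delta> + C V\<close> with independent half-normal \<open>U\<close> and standard Gaussian \<open>V\<close>. The factor \<open>C\<close> may be
  any square root of \<open>\<Omega> - \<delta> \<delta>\<^sup>T\<close>, which allows it to be adapted to a second scale matrix.
\<close>

lemma skew_normal_representation:
  fixes \<Omega> C :: "real^'m^'m"
  assumes Z: "skew_normal_star P Z \<mu> \<Omega> \<delta>" and C: "C ** transpose C = \<Omega> - outer_square \<delta>"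
    and g: "g \<in> borel_measurable borel"
  shows "(\<integral>\<^sup>+\<xi>. g (Z \<xi>) \<partial>P) = (\<integral>\<^sup>+u. (\<integral>\<^sup>+v. g (\<mu> + u *\<^sub>R \<delta> + C *v v) \<partial>gauss) \<partial>half_normal)"
proof -
  have \<Omega>: "pos_def \<Omega>" using Z by (simp add: skew_normal_star_def has_skew_normal_law_def)
  show ?thesis
  proof (rule skew_normal_law_representation[OF _ _ \<Omega> _ C g])
    show "distributed P lborel Z (\<lambda>z. ennreal (2 * mvn_density \<mu> \<Omega> z
        * cdf std_normal_distribution (\<delta> \<bullet> (matrix_inv \<Omega> *v (z - \<mu>)) / sqrt (1 - \<delta> \<bullet> (matrix_inv \<Omega> *v \<delta>)))))"
      using Z by (simp add: skew_normal_star_def has_skew_normal_law_def skew_normal_density_def[abs_def]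
          inner_alpha_of[OF \<Omega>])
  qed (use Z in \<open>simp_all add: skew_normal_star_def has_skew_normal_law_def admissible_delta_def\<close>)
qed

section \<open>Averaging over sign flips\<close>

definition sign_flip :: "'m set \<Rightarrow> 'm \<Rightarrow> real" where
  "sign_flip S i = (if i \<in> S then 1 else - 1)"

lemma orthogonal_transformation_sign_flip:
  "orthogonal_transformation (\<lambda>v. diagonal (sign_flip S) *v v :: real^'m)"
  unfolding orthogonal_transformation_def
  by (auto simp: inner_vec_def diagonal_mult_vec sign_flip_def intro!: sum.cong)

text \<open>
  The probability that independent random signs with means \<open>1 / s i\<close> are positive exactly on \<open>S\<close>.
\<close>

definition flip_weight :: "('m::finite \<Rightarrow> real) \<Rightarrow> 'm set \<Rightarrow> real" where
  "flip_weight s S = (\<Prod>i\<in>S. (1 + 1 / s i) / 2) * (\<Prod>i\<in>UNIV - S. (1 - 1 / s i) / 2)"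

lemma flip_weight_nonneg:
  assumes "\<And>i. 1 \<le> s i"
  shows "0 \<le> flip_weight s S"
proof -
  have "0 < s i" for i using assms[of i] by simp
  then show ?thesis
    unfolding flip_weight_def using assms
    by (intro mult_nonneg_nonneg prod_nonneg) (simp_all add: less_imp_le add_nonneg_nonneg)
qed

lemma sum_flip_weight: "(\<Sum>S\<in>UNIV. flip_weight s S) = 1"
proof -
  have "(\<Prod>i\<in>UNIV. (1 + 1 / s i) / 2 + (1 - 1 / s i) / 2) = (\<Sum>S\<in>Pow UNIV. flip_weight s S)"
    unfolding flip_weight_def by (rule prod_add) simp
  moreover have "(\<Prod>i\<in>UNIV. (1 + 1 / s i) / 2 + (1 - 1 / s i) / 2) = 1"
    by (intro prod.neutral) (simp add: field_simps)
  ultimately show ?thesis by simp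
qed

lemma sum_flip_weight_flip: "(\<Sum>S\<in>UNIV. flip_weight s S * sign_flip S i) = 1 / s i"
proof -
  let ?f = "\<lambda>j. (1 + 1 / s j) / 2" and ?g = "\<lambda>j. (if j = i then - 1 else 1) * ((1 - 1 / s j) / 2)"
  have "(\<Sum>S\<in>UNIV. flip_weight s S * sign_flip S i) = (\<Sum>S\<in>Pow UNIV. (\<Prod>j\<in>S. ?f j) * (\<Prod>j\<in>UNIV - S. ?g j))"
  proof (intro sum.cong refl)
    fix S :: "'a set"
    have "(\<Prod>j\<in>UNIV - S. if j = i then - 1 else 1) = sign_flip S i"
      by (subst prod.delta) (simp_all add: sign_flip_def)
    then show "flip_weight s S * sign_flip S i = (\<Prod>j\<in>S. ?f j) * (\<Prod>j\<in>UNIV - S. ?g j)"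
      unfolding flip_weight_def prod.distrib by simp
  qed simp
  also have "\<dots> = (\<Prod>j\<in>UNIV. ?f j + ?g j)" by (rule prod_add[symmetric]) simp
  also have "\<dots> = (\<Prod>j\<in>UNIV. if j = i then 1 / s i else 1)"
    by (intro prod.cong) (auto simp: field_simps)
  finally show ?thesis by simp
qed

text \<open>
  A random sign with mean \<open>1 / s i\<close> undoes the dilation by \<open>s i\<close> on average. So every vector is an average of sign flips of
  its dilation.
\<close>

lemma flip_average:
  fixes v :: "real^'m"
  assumes "\<And>i. 1 \<le> s i"
  shows "(\<Sum>S\<in>UNIV. flip_weight s S *\<^sub>R (diagonal s *v (diagonal (sign_flip S) *v v))) = v"
proof (simp add: vec_eq_iff, intro allI)
  fix i
  have "s i \<noteq> 0" using assms[of i] by auto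
  have "(\<Sum>S\<in>UNIV. flip_weight s S * (diagonal s *v (diagonal (sign_flip S) *v v)) $ i)
    = (\<Sum>S\<in>UNIV. flip_weight s S * sign_flip S i) * (s i * v $ i)"
    unfolding sum_distrib_right by (simp add: diagonal_mult_vec mult_ac)
  then show "(\<Sum>S\<in>UNIV. flip_weight s S * (diagonal s *v (diagonal (sign_flip S) *v v)) $ i) = v $ i"
    using \<open>s i \<noteq> 0\<close> by (simp add: sum_flip_weight_flip)
qed

lemma nn_integral_gauss_flip_average:
  fixes h :: "real^'m \<Rightarrow> ennreal"
  assumes [measurable]: "h \<in> borel_measurable borel" and s: "\<And>i. 1 \<le> s i"
  shows "(\<integral>\<^sup>+v. (\<Sum>S\<in>UNIV. ennreal (flip_weight s S) * h (diagonal (sign_flip S) *v v)) \<partial>gauss) = (\<integral>\<^sup>+v. h v \<partial>gauss)"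
proof -
  have "(\<integral>\<^sup>+v. (\<Sum>S\<in>UNIV. ennreal (flip_weight s S) * h (diagonal (sign_flip S) *v v)) \<partial>gauss)
    = (\<Sum>S\<in>UNIV. ennreal (flip_weight s S) * (\<integral>\<^sup>+v. h (diagonal (sign_flip S) *v v) \<partial>gauss))"
    by (subst nn_integral_sum) (measurable, simp add: nn_integral_cmult)
  also have "\<dots> = (\<Sum>S\<in>UNIV. ennreal (flip_weight s S)) * (\<integral>\<^sup>+v. h v \<partial>gauss)"
    by (simp add: nn_integral_gauss_orthogonal[OF orthogonal_transformation_sign_flip] sum_distrib_right)
  also have "(\<Sum>S\<in>UNIV. ennreal (flip_weight s S)) = 1"
    using flip_weight_nonneg[of s] s by (simp add: sum_ennreal sum_flip_weight)
  finally show ?thesis by simp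
qed

text \<open>
  An inequality between averages, rearranged so that it can be integrated without knowing that anything is integrable:
  each side only contains positive or negative parts.
\<close>

lemma ennreal_split_weighted_le:
  fixes a :: real and b w :: "'i \<Rightarrow> real"
  assumes fin: "finite I" and w: "\<And>i. i \<in> I \<Longrightarrow> 0 \<le> w i" and le: "a \<le> (\<Sum>i\<in>I. w i * b i)"
  shows "ennreal a + (\<Sum>i\<in>I. ennreal (w i) * ennreal (- b i)) \<le> (\<Sum>i\<in>I. ennreal (w i) * ennreal (b i)) + ennreal (- a)"
proof -
  have e: "ennreal x = ennreal (max x 0)" for x by (simp add: max_def ennreal_neg)
  have sum_e: "(\<Sum>i\<in>I. ennreal (w i) * ennreal (c i)) = ennreal (\<Sum>i\<in>I. w i * max (c i) 0)" for c
  proof -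
    have "ennreal (w i) * ennreal (c i) = ennreal (w i * max (c i) 0)" if "i \<in> I" for i
      using w[OF that] e[of "c i"] by (metis ennreal_mult max.cobounded2)
    then show ?thesis using w by (simp add: sum_ennreal)
  qed
  have nn: "0 \<le> (\<Sum>i\<in>I. w i * max (c i) 0)" for c using w by (intro sum_nonneg) auto
  have split: "(\<Sum>i\<in>I. w i * b i) = (\<Sum>i\<in>I. w i * max (b i) 0) - (\<Sum>i\<in>I. w i * max (- b i) 0)"
    unfolding sum_subtractf[symmetric] right_diff_distrib[symmetric] by (intro sum.cong) auto
  have "max a 0 + (\<Sum>i\<in>I. w i * max (- b i) 0) \<le> (\<Sum>i\<in>I. w i * max (b i) 0) + max (- a) 0"
    using le split by linarith
  then have "ennreal (max a 0 + (\<Sum>i\<in>I. w i * max (- b i) 0)) \<le> ennreal ((\<Sum>i\<in>I. w i * max (b i) 0) + max (- a) 0)"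
    by (rule ennreal_leI)
  then show ?thesis using nn
    by (simp add: ennreal_plus sum_e flip: e)
qed

lemma convex_on_affine_compose:
  assumes "convex_on UNIV f" "linear L"
  shows "convex_on UNIV (\<lambda>x. f (m + L x))"
proof (rule convex_onI)
  interpret linear L by fact
  fix t :: real and x y assume t: "0 < t" "t < 1"
  have "m + L ((1 - t) *\<^sub>R x + t *\<^sub>R y) = (1 - t) *\<^sub>R (m + L x) + t *\<^sub>R (m + L y)"
    unfolding add scale by (simp add: algebra_simps)
  then show "f (m + L ((1 - t) *\<^sub>R x + t *\<^sub>R y)) \<le> (1 - t) * f (m + L x) + t * f (m + L y)"
    using convex_onD[OF assms(1), of t "m + L x" "m + L y"] t by simp
qed simp

text \<open>
  By convexity and \<open>flip_average\<close>, \<open>f v\<close> is at most the average of \<open>f\<close> over the sign flips of the dilated vector. Integration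
  removes the signs, as the Gaussian measure is invariant under them.
\<close>

lemma gauss_dilation_convex:
  fixes f :: "real^'m \<Rightarrow> real"
  assumes f: "convex_on UNIV f" and s: "\<And>i. 1 \<le> s i"
  shows "(\<integral>\<^sup>+v. ennreal (f v) \<partial>gauss) + (\<integral>\<^sup>+v. ennreal (- f (diagonal s *v v)) \<partial>gauss)
    \<le> (\<integral>\<^sup>+v. ennreal (f (diagonal s *v v)) \<partial>gauss) + (\<integral>\<^sup>+v. ennreal (- f v) \<partial>gauss)"
proof -
  have [measurable]: "f \<in> borel_measurable borel"
    using convex_on_continuous[OF open_UNIV f] by (rule borel_measurable_continuous_onI)
  let ?y = "\<lambda>S v. diagonal s *v (diagonal (sign_flip S) *v v)"
  have point: "ennreal (f v) + (\<Sum>S\<in>UNIV. ennreal (flip_weight s S) * ennreal (- f (?y S v)))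
    \<le> (\<Sum>S\<in>UNIV. ennreal (flip_weight s S) * ennreal (f (?y S v))) + ennreal (- f v)" for v
  proof (rule ennreal_split_weighted_le)
    show "f v \<le> (\<Sum>S\<in>UNIV. flip_weight s S * f (?y S v))"
      using convex_on_sum[OF _ _ f sum_flip_weight[of s], of "\<lambda>S. ?y S v"] flip_weight_nonneg[of s] s
      by (simp add: flip_average)
  qed (use flip_weight_nonneg[of s] s in auto)
  have "(\<integral>\<^sup>+v. ennreal (f v) \<partial>gauss) + (\<integral>\<^sup>+v. ennreal (- f (diagonal s *v v)) \<partial>gauss)
    = (\<integral>\<^sup>+v. ennreal (f v) + (\<Sum>S\<in>UNIV. ennreal (flip_weight s S) * ennreal (- f (?y S v))) \<partial>gauss)"
    by (subst nn_integral_add) (measurable, use nn_integral_gauss_flip_average[of "\<lambda>v. ennreal (- f (diagonal s *v v))" s] s in simp)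
  also have "\<dots> \<le> (\<integral>\<^sup>+v. (\<Sum>S\<in>UNIV. ennreal (flip_weight s S) * ennreal (f (?y S v))) + ennreal (- f v) \<partial>gauss)"
    by (rule nn_integral_mono) (rule point)
  also have "\<dots> = (\<integral>\<^sup>+v. ennreal (f (diagonal s *v v)) \<partial>gauss) + (\<integral>\<^sup>+v. ennreal (- f v) \<partial>gauss)"
    by (subst nn_integral_add) (measurable, use nn_integral_gauss_flip_average[of "\<lambda>v. ennreal (f (diagonal s *v v))" s] s in simp)
  finally show ?thesis .
qed

section \<open>Sufficiency\<close>

lemma enn2ereal_diff_le:
  assumes "a + d \<le> c + b" "a < \<infinity> \<or> b < \<infinity>" "c < \<infinity> \<or> d < \<infinity>"
  shows "enn2ereal a - enn2ereal b \<le> enn2ereal c - enn2ereal d"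
  using assms
  by (cases a; cases b; cases c; cases d) (auto simp: top.extremum_unique ennreal_plus[symmetric] simp del: ennreal_plus)

text \<open>
  Given the half-normal variable, the two vectors are \<open>m + C V\<close> and \<open>m + C (diag s) V\<close> with the same centre \<open>m\<close>, so the Gaussian
  dilation inequality applies for each of its values. Both hypotheses on the expectations enter only in the last step,
  where the rearranged inequality is turned back into a comparison of extended reals.
\<close>

theorem skew_normal_convex_order:
  fixes X :: "'a \<Rightarrow> real^'m" and Y :: "'b \<Rightarrow> real^'m"
  assumes X: "skew_normal_star P X \<mu> \<Omega> \<delta>" and Y: "skew_normal_star Q Y \<mu> \<Omega>' \<delta>"
    and le: "pos_semidef (\<Omega>' - \<Omega>)"
  shows "convex_order P X Q Y"
proof -
  have \<Omega>: "pos_def \<Omega>" "admissible_delta \<Omega> \<delta>" "pos_def \<Omega>'"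
    using X Y by (simp_all add: skew_normal_star_def has_skew_normal_law_def)
  have "\<Omega>' - outer_square \<delta> - (\<Omega> - outer_square \<delta>) = \<Omega>' - \<Omega>" by simp
  moreover have "transpose (\<Omega>' - outer_square \<delta>) = \<Omega>' - outer_square \<delta>"
    using \<Omega>(3) by (simp add: pos_def_def outer_square_def transpose_def vec_eq_iff mult.commute)
  ultimately obtain C :: "real^'m^'m" and s where C: "C ** transpose C = \<Omega> - outer_square \<delta>"
      "(C ** diagonal s) ** transpose (C ** diagonal s) = \<Omega>' - outer_square \<delta>" and s: "\<And>i. 1 \<le> s i"
    using simultaneous_diagonalisation[OF pos_def_minus_outer_square[OF \<Omega>(1,2)], of "\<Omega>' - outer_square \<delta>"] le
    by metis
  show ?thesis
    unfolding convex_order_def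
  proof (intro allI impI)
    fix f :: "real^'m \<Rightarrow> real"
    assume f: "convex_on UNIV f" and def: "expectation_defined P (\<lambda>\<xi>. f (X \<xi>))" "expectation_defined Q (\<lambda>\<xi>. f (Y \<xi>))"
    have [measurable]: "f \<in> borel_measurable borel"
      using convex_on_continuous[OF open_UNIV f] by (rule borel_measurable_continuous_onI)
    interpret prob_space "gauss :: (real^'m) measure" by (rule prob_space_gauss)
    have "(\<integral>\<^sup>+\<xi>. ennreal (f (X \<xi>)) \<partial>P) + (\<integral>\<^sup>+\<xi>. ennreal (- f (Y \<xi>)) \<partial>Q)
      = (\<integral>\<^sup>+u. (\<integral>\<^sup>+v. ennreal (f (\<mu> + u *\<^sub>R \<delta> + C *v v)) \<partial>gauss)
          + (\<integral>\<^sup>+v. ennreal (- f (\<mu> + u *\<^sub>R \<delta> + C *v (diagonal s *v v))) \<partial>gauss) \<partial>half_normal)"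
      using skew_normal_representation[OF X C(1), of "\<lambda>x. ennreal (f x)"]
        skew_normal_representation[OF Y C(2), of "\<lambda>x. ennreal (- f x)"]
      by (subst nn_integral_add) (simp_all add: matrix_vector_mul_assoc[symmetric])
    also have "\<dots> \<le> (\<integral>\<^sup>+u. (\<integral>\<^sup>+v. ennreal (f (\<mu> + u *\<^sub>R \<delta> + C *v (diagonal s *v v))) \<partial>gauss)
          + (\<integral>\<^sup>+v. ennreal (- f (\<mu> + u *\<^sub>R \<delta> + C *v v)) \<partial>gauss) \<partial>half_normal)"
      by (intro nn_integral_mono gauss_dilation_convex[OF convex_on_affine_compose[OF f matrix_vector_mul_linear]] s)
    also have "\<dots> = (\<integral>\<^sup>+\<xi>. ennreal (f (Y \<xi>)) \<partial>Q) + (\<integral>\<^sup>+\<xi>. ennreal (- f (X \<xi>)) \<partial>P)"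
      using skew_normal_representation[OF X C(1), of "\<lambda>x. ennreal (- f x)"]
        skew_normal_representation[OF Y C(2), of "\<lambda>x. ennreal (f x)"]
      by (subst nn_integral_add) (simp_all add: matrix_vector_mul_assoc[symmetric])
    finally show "ext_expectation P (\<lambda>\<xi>. f (X \<xi>)) \<le> ext_expectation Q (\<lambda>\<xi>. f (Y \<xi>))"
      using def unfolding ext_expectation_def expectation_defined_def by (intro enn2ereal_diff_le) auto
  qed
qed

lemma convex_order_linear_image:
  assumes ord: "convex_order P X Q Y" and L: "linear L"
  shows "convex_order P (\<lambda>\<xi>. L (X \<xi>)) Q (\<lambda>\<xi>. L (Y \<xi>))"
  using ord convex_on_affine_compose[OF _ L, of _ 0] unfolding convex_order_def by auto

section \<open>Necessity\<close>

text \<open>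
  In the second moment the mixed term vanishes, because \<open>V\<close> has mean 0 and is independent of \<open>U\<close>.
\<close>

lemma half_normal_gauss_moments:
  fixes C :: "real^'m^'m" and a \<delta> :: "real^'m"
  shows "integrable (half_normal \<Otimes>\<^sub>M gauss) (\<lambda>(u, v). a \<bullet> (u *\<^sub>R \<delta> + C *v v))"
    and "integral\<^sup>L (half_normal \<Otimes>\<^sub>M gauss) (\<lambda>(u, v). a \<bullet> (u *\<^sub>R \<delta> + C *v v)) = integral\<^sup>L half_normal (\<lambda>u. u) * (a \<bullet> \<delta>)"
    and "integrable (half_normal \<Otimes>\<^sub>M gauss) (\<lambda>(u, v). (a \<bullet> (u *\<^sub>R \<delta> + C *v v))\<^sup>2)"
    and "integral\<^sup>L (half_normal \<Otimes>\<^sub>M gauss) (\<lambda>(u, v). (a \<bullet> (u *\<^sub>R \<delta> + C *v v))\<^sup>2)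
      = a \<bullet> ((outer_square \<delta> + C ** transpose C) *v a)"
proof -
  interpret H: prob_space half_normal by (rule prob_space_half_normal)
  interpret G: prob_space "gauss :: (real^'m) measure" by (rule prob_space_gauss)
  interpret HG: pair_prob_space half_normal "gauss :: (real^'m) measure" ..
  define c where "c = transpose C *v a"
  have aC: "a \<bullet> (C *v v) = c \<bullet> v" for v by (simp add: c_def dot_lmul_matrix[symmetric] transpose_matrix_vector)
  have c_sq: "c \<bullet> c = a \<bullet> ((C ** transpose C) *v a)"
    using dot_conjugate_mult_vec[of a C "mat 1"] by (simp add: c_def)
  define b where "b = a \<bullet> \<delta>"
  have lin: "a \<bullet> (u *\<^sub>R \<delta> + C *v v) = u * b + c \<bullet> v" for u v
    by (simp add: inner_add_right aC b_def)
  have sq: "(a \<bullet> (u *\<^sub>R \<delta> + C *v v))\<^sup>2 = b\<^sup>2 * u\<^sup>2 + (c \<bullet> v)\<^sup>2 + 2 * b * (u * (c \<bullet> v))" for u v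
    unfolding lin by (simp add: power2_eq_square algebra_simps)
  have fst: "integrable (half_normal \<Otimes>\<^sub>M (gauss :: (real^'m) measure)) (\<lambda>x. h (fst x))"
      "integral\<^sup>L (half_normal \<Otimes>\<^sub>M (gauss :: (real^'m) measure)) (\<lambda>x. h (fst x)) = integral\<^sup>L half_normal h"
    if h: "integrable half_normal h" for h :: "real \<Rightarrow> real"
  proof -
    have hm: "h \<in> borel_measurable half_normal" using h by (rule borel_measurable_integrable)
    have d: "distr (half_normal \<Otimes>\<^sub>M (gauss :: (real^'m) measure)) half_normal fst = half_normal"
      by (rule G.distr_pair_fst)
    show "integrable (half_normal \<Otimes>\<^sub>M (gauss :: (real^'m) measure)) (\<lambda>x. h (fst x))"
      using integrable_distr_eq[OF measurable_fst hm, of "gauss :: (real^'m) measure"] h by (simp add: d)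
    show "integral\<^sup>L (half_normal \<Otimes>\<^sub>M (gauss :: (real^'m) measure)) (\<lambda>x. h (fst x)) = integral\<^sup>L half_normal h"
      using integral_distr[OF measurable_fst hm, of "gauss :: (real^'m) measure"] by (simp add: d)
  qed
  have snd: "integrable (half_normal \<Otimes>\<^sub>M gauss) (\<lambda>x. h (snd x))"
      "integral\<^sup>L (half_normal \<Otimes>\<^sub>M gauss) (\<lambda>x. h (snd x)) = integral\<^sup>L gauss h"
    if h: "integrable gauss h" for h :: "real^'m \<Rightarrow> real"
  proof -
    have hm: "h \<in> borel_measurable gauss" using h by (rule borel_measurable_integrable)
    have d: "distr (half_normal \<Otimes>\<^sub>M (gauss :: (real^'m) measure)) gauss snd = gauss"
    proof (rule measure_eqI)
      fix A assume "A \<in> sets (distr (half_normal \<Otimes>\<^sub>M (gauss :: (real^'m) measure)) gauss snd)"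
      then have A: "A \<in> sets (gauss :: (real^'m) measure)" by simp
      have "snd -` A \<inter> space (half_normal \<Otimes>\<^sub>M (gauss :: (real^'m) measure)) = space half_normal \<times> A"
        using A by (auto simp: space_pair_measure)
      then show "emeasure (distr (half_normal \<Otimes>\<^sub>M gauss) gauss snd) A = emeasure gauss A"
        using A H.emeasure_space_1 by (simp add: emeasure_distr G.emeasure_pair_measure_Times)
    qed simp
    show "integrable (half_normal \<Otimes>\<^sub>M gauss) (\<lambda>x. h (snd x))"
      using integrable_distr_eq[OF measurable_snd hm, of half_normal] h by (simp add: d)
    show "integral\<^sup>L (half_normal \<Otimes>\<^sub>M gauss) (\<lambda>x. h (snd x)) = integral\<^sup>L gauss h"
      using integral_distr[OF measurable_snd hm, of half_normal] by (simp add: d)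
  qed
  note u1 = fst[OF half_normal_mean(1)] and u2 = fst[OF half_normal_second_moment(1)]
  note v1 = snd[OF gauss_inner_moments(1)[of c]] and v2 = snd[OF gauss_inner_moments(3)[of c]]
  have uv: "integrable (half_normal \<Otimes>\<^sub>M gauss) (\<lambda>x. fst x * (c \<bullet> snd x))"
  proof (rule Bochner_Integration.integrable_bound)
    show "integrable (half_normal \<Otimes>\<^sub>M gauss) (\<lambda>x. (fst x)\<^sup>2 + (c \<bullet> snd x)\<^sup>2)"
      by (intro Bochner_Integration.integrable_add u2(1) v2(1))
    show "AE x in half_normal \<Otimes>\<^sub>M gauss. norm (fst x * (c \<bullet> snd x)) \<le> norm ((fst x)\<^sup>2 + (c \<bullet> snd x)\<^sup>2)"
    proof (intro AE_I2)
      fix x :: "real \<times> (real^'m)"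
      have "2 * (\<bar>fst x\<bar> * \<bar>c \<bullet> snd x\<bar>) \<le> (fst x)\<^sup>2 + (c \<bullet> snd x)\<^sup>2"
        using sum_squares_bound[of "\<bar>fst x\<bar>" "\<bar>c \<bullet> snd x\<bar>"] by (simp add: mult.assoc)
      moreover have "0 \<le> \<bar>fst x\<bar> * \<bar>c \<bullet> snd x\<bar>" by simp
      ultimately have "\<bar>fst x\<bar> * \<bar>c \<bullet> snd x\<bar> \<le> (fst x)\<^sup>2 + (c \<bullet> snd x)\<^sup>2" by linarith
      then show "norm (fst x * (c \<bullet> snd x)) \<le> norm ((fst x)\<^sup>2 + (c \<bullet> snd x)\<^sup>2)"
        by (simp add: abs_mult)
    qed
  qed measurable
  have uv0: "integral\<^sup>L (half_normal \<Otimes>\<^sub>M gauss) (\<lambda>x. fst x * (c \<bullet> snd x)) = 0"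
    by (subst HG.integral_fst'[OF uv, symmetric]) (simp add: gauss_inner_moments(2))
  have L: "(\<lambda>(u, v). a \<bullet> (u *\<^sub>R \<delta> + C *v v)) = (\<lambda>x. fst x * b + c \<bullet> snd x)"
    by (auto simp: lin fun_eq_iff)
  have S: "(\<lambda>(u, v). (a \<bullet> (u *\<^sub>R \<delta> + C *v v))\<^sup>2)
      = (\<lambda>x. b\<^sup>2 * (fst x)\<^sup>2 + (c \<bullet> snd x)\<^sup>2 + 2 * b * (fst x * (c \<bullet> snd x)))"
    by (auto simp: sq fun_eq_iff)
  have i1: "integrable (half_normal \<Otimes>\<^sub>M (gauss :: (real^'m) measure)) (\<lambda>x. fst x * b)"
    by (intro integrable_mult_left u1(1))
  have i2: "integrable (half_normal \<Otimes>\<^sub>M (gauss :: (real^'m) measure)) (\<lambda>x. b\<^sup>2 * (fst x)\<^sup>2)"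
    by (intro integrable_mult_right u2(1))
  have i3: "integrable (half_normal \<Otimes>\<^sub>M (gauss :: (real^'m) measure)) (\<lambda>x. 2 * b * (fst x * (c \<bullet> snd x)))"
    by (intro integrable_mult_right uv)
  have i4: "integrable (half_normal \<Otimes>\<^sub>M (gauss :: (real^'m) measure)) (\<lambda>x. b\<^sup>2 * (fst x)\<^sup>2 + (c \<bullet> snd x)\<^sup>2)"
    by (intro Bochner_Integration.integrable_add i2 v2(1))
  show "integrable (half_normal \<Otimes>\<^sub>M gauss) (\<lambda>(u, v). a \<bullet> (u *\<^sub>R \<delta> + C *v v))"
    unfolding L by (intro Bochner_Integration.integrable_add i1 v1(1))
  show "integral\<^sup>L (half_normal \<Otimes>\<^sub>M gauss) (\<lambda>(u, v). a \<bullet> (u *\<^sub>R \<delta> + C *v v)) = integral\<^sup>L half_normal (\<lambda>u. u) * (a \<bullet> \<delta>)"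
    unfolding L Bochner_Integration.integral_add[OF i1 v1(1)] v1(2) gauss_inner_moments(2)
      integral_mult_left_zero u1(2) by (simp add: b_def)
  show "integrable (half_normal \<Otimes>\<^sub>M gauss) (\<lambda>(u, v). (a \<bullet> (u *\<^sub>R \<delta> + C *v v))\<^sup>2)"
    unfolding S by (intro Bochner_Integration.integrable_add i4 i3)
  have "a \<bullet> ((outer_square \<delta> + C ** transpose C) *v a) = b\<^sup>2 + c \<bullet> c"
    by (simp add: c_sq matrix_vector_mult_add_rdistrib inner_add_right outer_square_mult_vec b_def
        power2_eq_square inner_commute)
  then show "integral\<^sup>L (half_normal \<Otimes>\<^sub>M gauss) (\<lambda>(u, v). (a \<bullet> (u *\<^sub>R \<delta> + C *v v))\<^sup>2)
      = a \<bullet> ((outer_square \<delta> + C ** transpose C) *v a)"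
    unfolding S Bochner_Integration.integral_add[OF i4 i3] Bochner_Integration.integral_add[OF i2 v2(1)]
      v2(2) gauss_inner_moments(4) integral_mult_right_zero uv0 u2(2) half_normal_second_moment(2) by simp
qed

lemma skew_normal_distr:
  fixes \<Omega> C :: "real^'m^'m"
  assumes Z: "skew_normal_star P Z \<mu> \<Omega> \<delta>" and C: "C ** transpose C = \<Omega> - outer_square \<delta>"
  shows "distr P borel Z = distr (half_normal \<Otimes>\<^sub>M gauss) borel (\<lambda>(u, v). \<mu> + u *\<^sub>R \<delta> + C *v v)"
proof (rule measure_eqI)
  interpret G: prob_space "gauss :: (real^'m) measure" by (rule prob_space_gauss)
  have [measurable]: "Z \<in> borel_measurable P"
    using Z by (auto simp: skew_normal_star_def has_skew_normal_law_def dest: distributed_measurable)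
  fix A :: "(real^'m) set" assume "A \<in> sets (distr P borel Z)"
  then have [measurable]: "A \<in> sets borel" by simp
  have "emeasure (distr P borel Z) A = (\<integral>\<^sup>+z. indicator A z \<partial>distr P borel Z)" by simp
  also have "\<dots> = (\<integral>\<^sup>+\<xi>. indicator A (Z \<xi>) \<partial>P)" by (rule nn_integral_distr) measurable
  also have "\<dots> = (\<integral>\<^sup>+u. (\<integral>\<^sup>+v. indicator A (\<mu> + u *\<^sub>R \<delta> + C *v v) \<partial>gauss) \<partial>half_normal)"
    by (rule skew_normal_representation[OF Z C]) measurable
  also have "\<dots> = (\<integral>\<^sup>+x. indicator A (case x of (u, v) \<Rightarrow> \<mu> + u *\<^sub>R \<delta> + C *v v) \<partial>(half_normal \<Otimes>\<^sub>M gauss))"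
    using G.nn_integral_fst[of "\<lambda>x. indicator A (case x of (u, v) \<Rightarrow> \<mu> + u *\<^sub>R \<delta> + C *v v)" half_normal] by simp
  also have "\<dots> = (\<integral>\<^sup>+z. indicator A z \<partial>distr (half_normal \<Otimes>\<^sub>M gauss) borel (\<lambda>(u, v). \<mu> + u *\<^sub>R \<delta> + C *v v))"
    by (rule nn_integral_distr[symmetric]) measurable
  finally show "emeasure (distr P borel Z) A
      = emeasure (distr (half_normal \<Otimes>\<^sub>M gauss) borel (\<lambda>(u, v). \<mu> + u *\<^sub>R \<delta> + C *v v)) A" by simp
qed simp

lemma skew_normal_moments:
  fixes \<Omega> :: "real^'m^'m"
  assumes Z: "skew_normal_star P Z \<mu> \<Omega> \<delta>"
  shows "integrable P (\<lambda>\<xi>. a \<bullet> (Z \<xi> - \<mu>))"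
    and "integral\<^sup>L P (\<lambda>\<xi>. a \<bullet> (Z \<xi> - \<mu>)) = integral\<^sup>L half_normal (\<lambda>u. u) * (a \<bullet> \<delta>)"
    and "integrable P (\<lambda>\<xi>. (a \<bullet> (Z \<xi> - \<mu>))\<^sup>2)"
    and "integral\<^sup>L P (\<lambda>\<xi>. (a \<bullet> (Z \<xi> - \<mu>))\<^sup>2) = a \<bullet> (\<Omega> *v a)"
proof -
  have "pos_def \<Omega>" "admissible_delta \<Omega> \<delta>"
    using Z by (simp_all add: skew_normal_star_def has_skew_normal_law_def)
  then obtain C :: "real^'m^'m" where C: "C ** transpose C = \<Omega> - outer_square \<delta>"
    using pos_def_square_root_factor[OF pos_def_minus_outer_square] by metis
  have Zm: "Z \<in> borel_measurable P"
    using Z by (auto simp: skew_normal_star_def has_skew_normal_law_def dest: distributed_measurable)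
  have m: "(\<lambda>(u, v). \<mu> + u *\<^sub>R \<delta> + C *v v) \<in> borel_measurable (half_normal \<Otimes>\<^sub>M gauss)" by measurable
  have transfer: "integrable P (\<lambda>\<xi>. h (Z \<xi>)) \<longleftrightarrow> integrable (half_normal \<Otimes>\<^sub>M gauss) (\<lambda>(u, v). h (\<mu> + u *\<^sub>R \<delta> + C *v v))"
    "integral\<^sup>L P (\<lambda>\<xi>. h (Z \<xi>)) = integral\<^sup>L (half_normal \<Otimes>\<^sub>M gauss) (\<lambda>(u, v). h (\<mu> + u *\<^sub>R \<delta> + C *v v))"
    if h: "h \<in> borel_measurable borel" for h :: "real^'m \<Rightarrow> real"
    using integrable_distr_eq[OF Zm h] integrable_distr_eq[OF m h] integral_distr[OF Zm h] integral_distr[OF m h]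
    by (simp_all add: skew_normal_distr[OF Z C] case_prod_unfold)
  have 1: "(\<lambda>z. a \<bullet> (z - \<mu>)) \<in> borel_measurable borel" by measurable
  have 2: "(\<lambda>z. (a \<bullet> (z - \<mu>))\<^sup>2) \<in> borel_measurable borel" by measurable
  have e: "\<mu> + u *\<^sub>R \<delta> + C *v v - \<mu> = u *\<^sub>R \<delta> + C *v v" for u v by simp
  have \<Omega>: "outer_square \<delta> + C ** transpose C = \<Omega>" by (simp add: C)
  note M = half_normal_gauss_moments[of a \<delta> C]
  show "integrable P (\<lambda>\<xi>. a \<bullet> (Z \<xi> - \<mu>))" unfolding transfer(1)[OF 1] e by (rule M(1))
  show "integral\<^sup>L P (\<lambda>\<xi>. a \<bullet> (Z \<xi> - \<mu>)) = integral\<^sup>L half_normal (\<lambda>u. u) * (a \<bullet> \<delta>)"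
    unfolding transfer(2)[OF 1] e by (rule M(2))
  show "integrable P (\<lambda>\<xi>. (a \<bullet> (Z \<xi> - \<mu>))\<^sup>2)" unfolding transfer(1)[OF 2] e by (rule M(3))
  show "integral\<^sup>L P (\<lambda>\<xi>. (a \<bullet> (Z \<xi> - \<mu>))\<^sup>2) = a \<bullet> (\<Omega> *v a)"
    unfolding transfer(2)[OF 2] e M(4) \<Omega> ..
qed

text \<open>
  For integrable functions the extended expectation is the Bochner integral, so the moments can be compared in the
  convex order.
\<close>

lemma ext_expectation_integrable:
  assumes "integrable P g"
  shows "expectation_defined P g" "ext_expectation P g = ereal (integral\<^sup>L P g)"
proof -
  have g: "g \<in> borel_measurable P" "(\<integral>\<^sup>+\<xi>. ennreal (g \<xi>) \<partial>P) < \<infinity>" "(\<integral>\<^sup>+\<xi>. ennreal (- g \<xi>) \<partial>P) < \<infinity>"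
    using assms by (auto simp: real_integrable_def less_top)
  then show "expectation_defined P g" by (simp add: expectation_defined_def)
  obtain p n where "(\<integral>\<^sup>+\<xi>. ennreal (g \<xi>) \<partial>P) = ennreal p" "(\<integral>\<^sup>+\<xi>. ennreal (- g \<xi>) \<partial>P) = ennreal n" "0 \<le> p" "0 \<le> n"
    using g(2,3) by (metis ennreal_cases infinity_ennreal_def less_irrefl)
  then show "ext_expectation P g = ereal (integral\<^sup>L P g)"
    by (simp add: ext_expectation_def real_lebesgue_integral_def[OF assms])
qed

lemma convex_order_integral_le:
  assumes "convex_order P X Q Y" "convex_on UNIV f" "integrable P (\<lambda>\<xi>. f (X \<xi>))" "integrable Q (\<lambda>\<xi>. f (Y \<xi>))"
  shows "integral\<^sup>L P (\<lambda>\<xi>. f (X \<xi>)) \<le> integral\<^sup>L Q (\<lambda>\<xi>. f (Y \<xi>))"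
  using assms ext_expectation_integrable[OF assms(3)] ext_expectation_integrable[OF assms(4)]
  unfolding convex_order_def by (metis ereal_less_eq(3))

text \<open>
  The linear functions \<open>a \<bullet> (x - \<mu>)\<close> are convex together with their negatives, so the means agree; the means are the
  parameters \<open>\<delta>\<close> and \<open>\<delta>'\<close> times the same positive number. The squares of these functions are convex, and their expectations
  are the quadratic forms of \<open>\<Omega>\<close> and \<open>\<Omega>'\<close>.
\<close>

theorem skew_normal_convex_order_imp:
  fixes X :: "'a \<Rightarrow> real^'m" and Y :: "'b \<Rightarrow> real^'m"
  assumes X: "skew_normal_star P X \<mu> \<Omega> \<delta>" and Y: "skew_normal_star Q Y \<mu> \<Omega>' \<delta>'"
    and ord: "convex_order P X Q Y"
  shows "\<delta> = \<delta>'" "pos_semidef (\<Omega>' - \<Omega>)"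
proof -
  have lin: "convex_on UNIV (\<lambda>x. a \<bullet> (x - \<mu>))" for a :: "real^'m"
    by (rule convex_onI) (simp_all add: inner_diff_right inner_add_right algebra_simps)
  have sq: "convex_on UNIV (\<lambda>x. (a \<bullet> (x - \<mu>))\<^sup>2)" for a :: "real^'m"
    using convex_on_affine_compose[OF convex_power2 bounded_linear.linear[OF bounded_linear_inner_right[of a]],
        of "- (a \<bullet> \<mu>)"]
    by (simp add: inner_diff_right)
  have le: "a \<bullet> \<delta> \<le> a \<bullet> \<delta>'" for a
    using convex_order_integral_le[OF ord lin[of a] skew_normal_moments(1)[OF X] skew_normal_moments(1)[OF Y]]
      half_normal_mean(2) by (simp add: skew_normal_moments(2)[OF X] skew_normal_moments(2)[OF Y])
  have "a \<bullet> \<delta> = a \<bullet> \<delta>'" for a using le[of a] le[of "- a"] by simp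
  then show "\<delta> = \<delta>'" by (metis vector_eq_rdot inner_commute)
  have "a \<bullet> (\<Omega> *v a) \<le> a \<bullet> (\<Omega>' *v a)" for a
    using convex_order_integral_le[OF ord sq[of a] skew_normal_moments(3)[OF X] skew_normal_moments(3)[OF Y]]
    by (simp add: skew_normal_moments(4)[OF X] skew_normal_moments(4)[OF Y])
  moreover have "transpose (\<Omega>' - \<Omega>) = \<Omega>' - \<Omega>"
    using X Y by (simp add: skew_normal_star_def has_skew_normal_law_def pos_def_def transpose_def vec_eq_iff)
  ultimately show "pos_semidef (\<Omega>' - \<Omega>)"
    by (simp add: pos_semidef_def matrix_vector_mult_diff_rdistrib inner_diff_right)
qed

section \<open>Matrix variate skew-normal laws\<close>

definition unvectorize :: "real^('p \<times> 'n) \<Rightarrow> real^'p^'n" where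
  "unvectorize x = (\<chi> i j. x $ (j, i))"

lemma linear_vectorize: "linear vectorize" and linear_unvectorize: "linear unvectorize"
  by (rule linearI; simp add: vectorize_def unvectorize_def vec_eq_iff)+

lemma unvectorize_vectorize [simp]: "unvectorize (vectorize A) = A"
  by (simp add: unvectorize_def vectorize_def vec_eq_iff)

text \<open>
  Composition with a linear map preserves convexity, and \<open>vectorize\<close> is a linear bijection.
\<close>

lemma convex_order_vectorize:
  "convex_order P (\<lambda>\<xi>. vectorize (X \<xi>)) Q (\<lambda>\<xi>. vectorize (Y \<xi>)) \<longleftrightarrow> convex_order P X Q Y"
  using convex_order_linear_image[OF _ linear_vectorize, of P X Q Y]
    convex_order_linear_image[OF _ linear_unvectorize, of P "\<lambda>\<xi>. vectorize (X \<xi>)" Q "\<lambda>\<xi>. vectorize (Y \<xi>)"]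
  by auto

theorem theorem5p2:
  fixes P :: "'a measure" and Q :: "'b measure" and P0 :: "'c measure" and Q0 :: "'d measure"
    and X :: "'a \<Rightarrow> real^'p^'n" and Y :: "'b \<Rightarrow> real^'p^'n"
    and X0 :: "'c \<Rightarrow> real^'p^'n" and Y0 :: "'d \<Rightarrow> real^'p^'n"
    and M M' B B' :: "real^'p^'n"
    and V V' :: "real^'p^'p" and \<Sigma> \<Sigma>' :: "real^'n^'n"
    and \<Omega> \<Omega>' :: "real^('p \<times> 'n)^('p \<times> 'n)"
    and \<delta> \<delta>' :: "real^('p \<times> 'n)"
  assumes "pos_def V" "pos_def V'" "pos_def \<Sigma>" "pos_def \<Sigma>'"
    and "\<Omega> = V \<otimes>\<^sub>K \<Sigma>" "\<Omega>' = V' \<otimes>\<^sub>K \<Sigma>'"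
    and "matrix_skew_normal P X M \<Omega> B \<delta>"
    and "matrix_skew_normal Q Y M' \<Omega>' B' \<delta>'"
  shows "(M = M' \<and> \<delta> = \<delta>' \<and> pos_semidef (\<Omega>' - \<Omega>) \<longrightarrow> convex_order P X Q Y) \<and>
    (matrix_skew_normal_star P0 X0 0 (correlation \<Omega>) \<delta> \<and>
     matrix_skew_normal_star Q0 Y0 0 (correlation \<Omega>') \<delta>' \<longrightarrow>
     (convex_order P0 X0 Q0 Y0 \<longleftrightarrow>
      \<delta> = \<delta>' \<and> pos_semidef (correlation \<Omega>' - correlation \<Omega>)))"
proof (intro conjI impI)
  assume "M = M' \<and> \<delta> = \<delta>' \<and> pos_semidef (\<Omega>' - \<Omega>)"
  moreover have "skew_normal_star P (\<lambda>\<xi>. vectorize (X \<xi>)) (vectorize M) \<Omega> \<delta>"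
    "skew_normal_star Q (\<lambda>\<xi>. vectorize (Y \<xi>)) (vectorize M') \<Omega>' \<delta>'"
    using assms(7,8) by (auto simp: matrix_skew_normal_def intro: skew_normal_imp_star)
  ultimately show "convex_order P X Q Y"
    using skew_normal_convex_order unfolding convex_order_vectorize[of P X, symmetric] by blast
next
  assume "matrix_skew_normal_star P0 X0 0 (correlation \<Omega>) \<delta> \<and> matrix_skew_normal_star Q0 Y0 0 (correlation \<Omega>') \<delta>'"
  then have "skew_normal_star P0 (\<lambda>\<xi>. vectorize (X0 \<xi>)) (vectorize 0) (correlation \<Omega>) \<delta>"
    "skew_normal_star Q0 (\<lambda>\<xi>. vectorize (Y0 \<xi>)) (vectorize 0) (correlation \<Omega>') \<delta>'"
    by (simp_all add: matrix_skew_normal_star_def)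
  note skew_normal_convex_order[OF this(1)] skew_normal_convex_order_imp[OF this] this(2)
  then show "convex_order P0 X0 Q0 Y0 \<longleftrightarrow> \<delta> = \<delta>' \<and> pos_semidef (correlation \<Omega>' - correlation \<Omega>)"
    unfolding convex_order_vectorize[of P0 X0, symmetric] by metis
qed

end
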